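(* Let $(\bar A,\bar B)$ be the structural system of an interconnected dynamical system with subsystems $(\bar A_1,\bar B_1),\dots,(\bar A_r,\bar B_r)$ and connection patterns $\bar E_{i,j}$ ($i\neq j$). Then $(\bar A,\bar B)$ is structurally controllable if there exist maximum matchings $M_1,\dots,M_r$ of the state bipartite graphs $\mathcal B(\bar A_1),\dots,\mathcal B(\bar A_r)$, respectively, such that the following two conditions hold: 1. for each subsystem $(\bar A_j,\bar B_j)$, $j=1,\dots,r$, the non-top linked strongly connected components of $\mathcal D(\bar A_j,\bar B_j)$ consist of input vertices; and 2. the bipartite graph $$\mathcal B\Big(\bigcup_{i=1}^r\mathcal U_L(M_i),\ \bigcup_{i=1}^r\mathcal U_R(M_i),\ \bigcup_{i=1}^r\bigcup_{j\neq i}\mathcal E_{\mathcal U_L(M_j),\mathcal U_R(M_i)}\Big)$$ admits a perfect matching, where $\mathcal U_L(M_i)$ and $\mathcal U_R(M_i)$ are the sets of left- and right-unmatched vertices of $M_i$, and $\mathcal E_{\mathcal U_L(M_j),\mathcal U_R(M_i)}$ is the set of edges of the state digraph $\mathcal D(\bar A)$ from vertices in $\mathcal U_L(M_j)$ to vertices in $\mathcal U_R(M_i)$.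
   Context: Setting: there are $r$ subsystems with binary matrices $\bar A_i\in\{0,1\}^{n_i\times n_i}$, $\bar B_i\in\{0,1\}^{n_i\times p_i}$, and, for $i\ne j$, a binary matrix $\bar E_{i,j}\in\{0,1\}^{n_i\times n_j}$ (the sparsity pattern of the connection matrix from subsystem $j$ to subsystem $i$). With $n=\sum_i n_i$, $p=\sum_i p_i$, the overall $\bar A\in\{0,1\}^{n\times n}$ is the block matrix with diagonal blocks $\bar A_i$ and $(i,j)$ off-diagonal blocks $\bar E_{i,j}$, and $\bar B\in\{0,1\}^{n\times p}$ is block diagonal with diagonal blocks $\bar B_i$. Structural controllability: a pair of binary matrices $(\bar M,\bar N)$ is structurally controllable if there is a controllable pair of real matrices $(M,N)$ (for $\dot x=Mx+Nu$) with the same sparsity pattern, i.e. $M_{i,j}=0$ iff $\bar M_{i,j}=0$ and $N_{i,k}=0$ iff $\bar N_{i,k}=0$. Digraphs: $\mathcal D(\bar M)$ has the state vertices $x_1,x_2,\dots$ and an edge $(x_i,x_j)$ iff $\bar M_{j,i}=1$; $\mathcal D(\bar M,\bar N)$ has additionally the input vertices $u_1,u_2,\dots$ and edges $(u_j,x_i)$ iff $\bar N_{i,j}=1$. The state vertices of the subsystems are identified with the corresponding state vertices of the overall system. A strongly connected component (SCC) is non-top linked if no edge enters it from a vertex of another SCC. Bipartite graphs: $\mathcal B(S_1,S_2,F)$ has left vertex set $S_1$, right vertex set $S_2$ (regarded as disjoint copies) and edge set $F\subseteq S_1\times S_2$. The state bipartite graph $\mathcal B(\bar M)$ has the state vertices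 both as left set and as right set, and the edges of $\mathcal D(\bar M)$. A matching is a set of edges no two sharing a vertex; it is maximum if it has the largest possible number of edges, and perfect if every vertex, left and right, belongs to one of its edges. Left (right) vertices belonging to no edge of a matching are its left- (right-) unmatched vertices. *)

theory Defs
  imports
    Complex_Main
    "HOL-Library.Z2"
    "Jordan_Normal_Form.Matrix"
    "Graph_Theory.Graph_Theory"
begin

text \<open>
  Binary matrices are matrices over \<^typ>\<open>bit\<close>; only its two elements 0 and 1 matter, its field
  structure is not used. All indices (of rows, columns and subsystems) start at 0.
\<close>


section \<open>Controllability and structural controllability\<close>

text \<open>
  Controllability of \<open>x' = M x + N u\<close>: every state can be steered to every state in finite time.
  The type of vectors of varying dimension carries no topology, so continuity of the input and
  differentiability of the trajectory are stated componentwise.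
\<close>

definition controllable :: "real mat \<Rightarrow> real mat \<Rightarrow> bool" where
  "controllable M N \<longleftrightarrow>
    (\<forall>x\<^sub>0 \<in> carrier_vec (dim_row M). \<forall>x\<^sub>1 \<in> carrier_vec (dim_row M).
      \<exists>T > 0. \<exists>(u :: real \<Rightarrow> real vec) (x :: real \<Rightarrow> real vec).
        (\<forall>t \<in> {0..T}. u t \<in> carrier_vec (dim_col N) \<and> x t \<in> carrier_vec (dim_row M)) \<and>
        (\<forall>k < dim_col N. continuous_on {0..T} (\<lambda>t. u t $ k)) \<and>
        (\<forall>t \<in> {0..T}. \<forall>k < dim_row M.
          ((\<lambda>s. x s $ k) has_real_derivative (M *\<^sub>v x t + N *\<^sub>v u t) $ k) (at t within {0..T})) \<and>
        x 0 = x\<^sub>0 \<and> x T = x\<^sub>1)"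

definition same_pattern :: "real mat \<Rightarrow> bit mat \<Rightarrow> bool" where
  "same_pattern M M' \<longleftrightarrow>
    M \<in> carrier_mat (dim_row M') (dim_col M') \<and>
    (\<forall>i < dim_row M'. \<forall>j < dim_col M'. M $$ (i, j) = 0 \<longleftrightarrow> M' $$ (i, j) = 0)"

definition structurally_controllable :: "bit mat \<Rightarrow> bit mat \<Rightarrow> bool" where
  "structurally_controllable M' N' \<longleftrightarrow>
    (\<exists>M N. same_pattern M M' \<and> same_pattern N N' \<and> controllable M N)"


section \<open>Digraphs of structural systems\<close>

datatype vertex = State nat | Input nat

text \<open>The transposed index: the entry in row \<open>j\<close> and column \<open>i\<close> yields the edge from \<open>i\<close> to \<open>j\<close>.\<close>

definition state_digraph :: "bit mat \<Rightarrow> vertex pair_pre_digraph" where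
  "state_digraph M = \<lparr>
    pverts = State ` {..<dim_row M},
    parcs = {(State i, State j) | i j. i < dim_row M \<and> j < dim_row M \<and> M $$ (j, i) = 1} \<rparr>"

definition system_digraph :: "bit mat \<Rightarrow> bit mat \<Rightarrow> vertex pair_pre_digraph" where
  "system_digraph M N = \<lparr>
    pverts = pverts (state_digraph M) \<union> Input ` {..<dim_col N},
    parcs = parcs (state_digraph M) \<union>
      {(Input j, State i) | i j. i < dim_row M \<and> j < dim_col N \<and> N $$ (i, j) = 1} \<rparr>"

definition non_top_linked_scc :: "'a pair_pre_digraph \<Rightarrow> 'a set \<Rightarrow> bool" where
  "non_top_linked_scc G C \<longleftrightarrow>
    C \<in> pre_digraph.sccs_verts (with_proj G) \<and>
    \<not> (\<exists>C' \<in> pre_digraph.sccs_verts (with_proj G). C' \<noteq> C \<and>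
        (\<exists>v \<in> C'. \<exists>w \<in> C. (v, w) \<in> parcs G))"

definition edges_between :: "'a pair_pre_digraph \<Rightarrow> 'a set \<Rightarrow> 'a set \<Rightarrow> ('a \<times> 'a) set" where
  "edges_between G S T = parcs G \<inter> S \<times> T"


section \<open>Bipartite graphs and matchings\<close>

text \<open>
  The left and right vertices are regarded as disjoint copies, even if both come from the same
  set: an edge \<open>(v, w)\<close> joins the left vertex \<open>v\<close> to the right vertex \<open>w\<close>. Accordingly, two edges
  share a vertex iff their first components or their second components agree.
\<close>

record 'a bipartite =
  left_verts :: "'a set"
  right_verts :: "'a set"
  bip_edges :: "('a \<times> 'a) set"

definition state_bipartite :: "bit mat \<Rightarrow> vertex bipartite" where
  "state_bipartite M = \<lparr>
    left_verts = pverts (state_digraph M),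
    right_verts = pverts (state_digraph M),
    bip_edges = parcs (state_digraph M) \<rparr>"

definition bip_matching :: "'a bipartite \<Rightarrow> ('a \<times> 'a) set \<Rightarrow> bool" where
  "bip_matching G M \<longleftrightarrow>
    M \<subseteq> bip_edges G \<and> (\<forall>e \<in> M. \<forall>f \<in> M. e \<noteq> f \<longrightarrow> fst e \<noteq> fst f \<and> snd e \<noteq> snd f)"

text \<open>To be used for graphs with finitely many edges only, since cardinalities are compared.\<close>

definition maximum_matching :: "'a bipartite \<Rightarrow> ('a \<times> 'a) set \<Rightarrow> bool" where
  "maximum_matching G M \<longleftrightarrow>
    bip_matching G M \<and> (\<forall>M'. bip_matching G M' \<longrightarrow> card M' \<le> card M)"

definition left_unmatched :: "'a bipartite \<Rightarrow> ('a \<times> 'a) set \<Rightarrow> 'a set" where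
  "left_unmatched G M = {v \<in> left_verts G. \<forall>e \<in> M. fst e \<noteq> v}"

definition right_unmatched :: "'a bipartite \<Rightarrow> ('a \<times> 'a) set \<Rightarrow> 'a set" where
  "right_unmatched G M = {v \<in> right_verts G. \<forall>e \<in> M. snd e \<noteq> v}"

definition perfect_matching :: "'a bipartite \<Rightarrow> ('a \<times> 'a) set \<Rightarrow> bool" where
  "perfect_matching G M \<longleftrightarrow>
    bip_matching G M \<and> left_unmatched G M = {} \<and> right_unmatched G M = {}"


section \<open>Interconnected systems\<close>

text \<open>
  For block sizes \<open>ns 0, ns 1, \<dots>\<close>, \<open>block_start ns i\<close> is the first index of block \<open>i\<close>, and
  \<open>block_of ns k\<close> is the block that contains the index \<open>k\<close>.
\<close>

definition block_start :: "(nat \<Rightarrow> nat) \<Rightarrow> nat \<Rightarrow> nat" where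
  "block_start ns i = (\<Sum>j<i. ns j)"

definition block_of :: "(nat \<Rightarrow> nat) \<Rightarrow> nat \<Rightarrow> nat" where
  "block_of ns k = (LEAST i. k < block_start ns (Suc i))"

definition overall_state_mat ::
    "nat \<Rightarrow> (nat \<Rightarrow> nat) \<Rightarrow> (nat \<Rightarrow> bit mat) \<Rightarrow> (nat \<Rightarrow> nat \<Rightarrow> bit mat) \<Rightarrow> bit mat" where
  "overall_state_mat r ns A E =
    mat (\<Sum>i<r. ns i) (\<Sum>i<r. ns i) (\<lambda>(k, l).
      let i = block_of ns k; j = block_of ns l
      in (if i = j then A i else E i j) $$ (k - block_start ns i, l - block_start ns j))"

definition overall_input_mat :: "nat \<Rightarrow> (nat \<Rightarrow> bit mat) \<Rightarrow> bit mat" where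
  "overall_input_mat r B = diag_block_mat (map B [0..<r])"

text \<open>
  The identification of the vertices of subsystem \<open>i\<close>, with state dimensions \<open>ns\<close> and input
  dimensions \<open>ps\<close>, with vertices of the overall system.
\<close>

fun overall_vertex :: "(nat \<Rightarrow> nat) \<Rightarrow> (nat \<Rightarrow> nat) \<Rightarrow> nat \<Rightarrow> vertex \<Rightarrow> vertex" where
  "overall_vertex ns ps i (State k) = State (block_start ns i + k)"
| "overall_vertex ns ps i (Input k) = Input (block_start ps i + k)"

definition overall_left_unmatched ::
    "(nat \<Rightarrow> nat) \<Rightarrow> (nat \<Rightarrow> nat) \<Rightarrow> (nat \<Rightarrow> bit mat) \<Rightarrow> (nat \<Rightarrow> (vertex \<times> vertex) set) \<Rightarrow>
      nat \<Rightarrow> vertex set" where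
  "overall_left_unmatched ns ps A M i =
    overall_vertex ns ps i ` left_unmatched (state_bipartite (A i)) (M i)"

definition overall_right_unmatched ::
    "(nat \<Rightarrow> nat) \<Rightarrow> (nat \<Rightarrow> nat) \<Rightarrow> (nat \<Rightarrow> bit mat) \<Rightarrow> (nat \<Rightarrow> (vertex \<times> vertex) set) \<Rightarrow>
      nat \<Rightarrow> vertex set" where
  "overall_right_unmatched ns ps A M i =
    overall_vertex ns ps i ` right_unmatched (state_bipartite (A i)) (M i)"

lemma block_start_Suc: "block_start ns (Suc i) = block_start ns i + ns i"
  by (simp add: block_start_def)

lemma block_start_mono: "i \<le> j \<Longrightarrow> block_start ns i \<le> block_start ns j"
  unfolding block_start_def by (rule sum_mono2) auto

lemma block_of_block_start:
  assumes "k < ns i"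
  shows "block_of ns (block_start ns i + k) = i"
  unfolding block_of_def
proof (rule Least_equality)
  show "block_start ns i + k < block_start ns (Suc i)"
    using assms by (simp add: block_start_Suc)
next
  fix j assume "block_start ns i + k < block_start ns (Suc j)"
  then show "i \<le> j"
    using block_start_mono[of "Suc j" i ns] by (cases "i \<le> j") auto
qed

lemma block_start_add_less:
  assumes "i < r" "k < ns i"
  shows "block_start ns i + k < (\<Sum>i<r. ns i)"
  using block_start_mono[of "Suc i" r ns] assms
  by (simp add: block_start_Suc) (simp add: block_start_def)

lemma overall_state_mat_carrier:
  "overall_state_mat r ns A E \<in> carrier_mat (\<Sum>i<r. ns i) (\<Sum>i<r. ns i)"
  by (simp add: overall_state_mat_def)

lemma overall_state_mat_block:
  assumes "i < r" "j < r" "k < ns i" "l < ns j"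
  shows "overall_state_mat r ns A E $$ (block_start ns i + k, block_start ns j + l) =
    (if i = j then A i else E i j) $$ (k, l)"
  using assms
  by (simp add: overall_state_mat_def block_of_block_start block_start_add_less)

lemma overall_input_mat_carrier:
  assumes "\<And>i. i < r \<Longrightarrow> B i \<in> carrier_mat (ns i) (ps i)"
  shows "overall_input_mat r B \<in> carrier_mat (\<Sum>i<r. ns i) (\<Sum>i<r. ps i)"
proof (rule carrier_matI)
  have "map (\<lambda>i. dim_row (B i)) [0..<r] = map ns [0..<r]"
    "map (\<lambda>i. dim_col (B i)) [0..<r] = map ps [0..<r]"
    using carrier_matD[OF assms] by auto
  then show "dim_row (overall_input_mat r B) = (\<Sum>i<r. ns i)"
    "dim_col (overall_input_mat r B) = (\<Sum>i<r. ps i)"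
    by (simp_all add: overall_input_mat_def dim_diag_block_mat o_def
        interv_sum_list_conv_sum_set_nat lessThan_atLeast0)
qed

lemma overall_input_mat_block:
  assumes "\<And>i. i < r \<Longrightarrow> B i \<in> carrier_mat (ns i) (ps i)"
    and "i < r" "j < r" "k < ns i" "l < ps j"
  shows "overall_input_mat r B $$ (block_start ns i + k, block_start ps j + l) =
    (if i = j then B i $$ (k, l) else 0)"
  using assms
proof (induction r)
  case (Suc r)
  note dims = carrier_matD[OF Suc.prems(1)]
  have carr: "overall_input_mat r B \<in> carrier_mat (block_start ns r) (block_start ps r)"
    using overall_input_mat_carrier[of r B ns ps] Suc.prems(1) by (simp add: block_start_def)
  have Br: "B r \<in> carrier_mat (ns r) (ps r)"
    using Suc.prems(1) by simp
  have step: "overall_input_mat (Suc r) B =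
      four_block_mat (overall_input_mat r B) (0\<^sub>m (block_start ns r) (ps r))
        (0\<^sub>m (ns r) (block_start ps r)) (B r)"
    using carr Br by (simp add: overall_input_mat_def diag_block_mat_last Let_def)
  have row: "block_start ns i + k < block_start ns r" if "i < r"
    using block_start_add_less[of i r k ns] that Suc.prems by (simp add: block_start_def)
  have col: "block_start ps j + l < block_start ps r" if "j < r"
    using block_start_add_less[of j r l ps] that Suc.prems by (simp add: block_start_def)
  consider "i < r" "j < r" | "i < r" "j = r" | "i = r" "j < r" | "i = r" "j = r"
    using Suc.prems by linarith
  then show ?case
  proof cases
    case 1
    then show ?thesis
      using Suc row col carr Br unfolding step by (subst index_mat_four_block) (auto simp: dims)
  next
    case 2
    then show ?thesis
      using Suc.prems row carr Br unfolding step by (subst index_mat_four_block) (auto simp: dims)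
  next
    case 3
    then show ?thesis
      using Suc.prems col carr Br unfolding step by (subst index_mat_four_block) (auto simp: dims)
  next
    case 4
    then show ?thesis
      using Suc.prems carr Br unfolding step by (subst index_mat_four_block) (auto simp: dims)
  qed
qed simp

end

theory Submission
  imports
    Defs
    "Jordan_Normal_Form.Determinant"
    "HOL-Computational_Algebra.Field_as_Ring"
    "HOL-Computational_Algebra.Fundamental_Theorem_Algebra"
    "HOL-Combinatorics.Orbits"
begin

text \<open>
  Two properties of the overall system are established: the edges of its state digraph contain
  vertex-disjoint cycles through all states, and every state can be reached from an input.
  
  The cycles come from matchings. A perfect matching of the state bipartite graph is a permutation
  of the states along edges, and such a matching is obtained by adding to the matchings of the
  subsystems the perfect matching of their unmatched vertices (lemma
  \<open>permutation_of_matching\<close> turns it into a permutation). Reachability is inherited from the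
  subsystems: above every state there is a non-top linked component
  (\<open>ex_non_top_linked_scc_above\<close>), and it consists of inputs.
  
  That these two properties suffice is a case of Lin's theorem
  (\<open>structurally_controllable_if_cycles_and_driven\<close>). Keep only the cycles and, for each
  cycle, one edge that enters it from a place closer to the inputs; so the cycles form a forest
  rooted in the inputs. Give the cycles distinct weights. Then an eigenvalue belongs to one cycle
  only, and a left eigenvector is supported on the path from this cycle up to an input without
  being cancelled anywhere, so it is not orthogonal to the column of that input
  (\<open>no_hidden_eigenvector\<close>). By the Popov-Belevitch-Hautus test
  (\<open>det_gramian_if_no_hidden_eigenvector\<close>) the determinant of \<open>K K\<^sup>T\<close> for the Kalman matrix
  \<open>K\<close> is nonzero, and it remains nonzero when all other entries of the pattern are given small
  values (\<open>structurally_controllable_if_subpattern\<close>).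
  
  Finally, a nonzero determinant yields controllability in the sense of differential equations
  (\<open>controllable_if_det_gramian\<close>) by explicit polynomial trajectories: a polynomial curve between
  the two given states is chosen to be almost a free motion near both ends, and what it lacks of
  being a trajectory is moved into the range of the input matrix by repeated differentiation.
\<close>

section \<open>Steering along polynomial trajectories\<close>

text \<open>
  \<open>kalman n a b k i l\<close> is the entry \<open>(i, l)\<close> of \<open>a\<^sup>k b\<close>, the \<open>k\<close>-th block of the Kalman
  controllability matrix. Matrices are given by their entry functions here, so that entries can
  be summed, perturbed and differentiated without carrier conditions.
\<close>

primrec kalman :: "nat \<Rightarrow> (nat \<Rightarrow> nat \<Rightarrow> real) \<Rightarrow> (nat \<Rightarrow> nat \<Rightarrow> real) \<Rightarrow> nat \<Rightarrow> nat \<Rightarrow> nat \<Rightarrow> real"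
where
  "kalman n a b 0 i l = b i l"
| "kalman n a b (Suc k) i l = (\<Sum>j<n. a i j * kalman n a b k j l)"

text \<open>
  \<open>K K\<^sup>T\<close> for the Kalman matrix \<open>K = [b, a b, \<dots>, a\<^sup>n\<^sup>-\<^sup>1 b]\<close>. Its determinant is a single polynomial
  in the entries of \<open>a\<close> and \<open>b\<close> that is nonzero exactly when \<open>K\<close> has full row rank; so controllability
  becomes an open condition without a choice of a minor of \<open>K\<close>.
\<close>

definition gramian :: "nat \<Rightarrow> nat \<Rightarrow> (nat \<Rightarrow> nat \<Rightarrow> real) \<Rightarrow> (nat \<Rightarrow> nat \<Rightarrow> real) \<Rightarrow> real mat" where
  "gramian n p a b =
    mat n n (\<lambda>(i, j). \<Sum>k<n. \<Sum>l<p. kalman n a b k i l * kalman n a b k j l)"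

text \<open>
  The trajectories used for steering are polynomials in time, and all calculus is done on formal
  polynomials. The residual is what \<open>x' = a x\<close> fails by, hence what the input has to provide.
\<close>

definition residual :: "nat \<Rightarrow> (nat \<Rightarrow> nat \<Rightarrow> real) \<Rightarrow> (nat \<Rightarrow> real poly) \<Rightarrow> nat \<Rightarrow> real poly" where
  "residual n a x i = pderiv (x i) - (\<Sum>j<n. smult (a i j) (x j))"

lemma smult_sum_right: "smult c (\<Sum>s\<in>S. f s) = (\<Sum>s\<in>S. smult c (f s))"
  by (induction S rule: infinite_finite_induct) (simp_all add: smult_add_right)

lemma residual_add:
  "residual n a (\<lambda>i. x i + y i) i = residual n a x i + residual n a y i"
  by (simp add: residual_def pderiv_add smult_add_right sum.distrib)

lemma residual_diff:
  "residual n a (\<lambda>i. x i - y i) i = residual n a x i - residual n a y i"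
  by (simp add: residual_def pderiv_diff smult_diff_right sum_subtractf)

lemma residual_mult:
  "residual n a (\<lambda>i. c * x i) i = pderiv c * x i + c * residual n a x i"
  by (simp add: residual_def pderiv_mult algebra_simps sum_distrib_left)

text \<open>
  A residual \<open>f\<close> that is not of the form \<open>b u\<close> can still be compensated if the trajectory may be
  changed by some \<open>x\<close>. As \<open>x\<close> vanishes at the times 0 and 1, the change keeps the end points.
\<close>

definition absorbable ::
    "nat \<Rightarrow> nat \<Rightarrow> (nat \<Rightarrow> nat \<Rightarrow> real) \<Rightarrow> (nat \<Rightarrow> nat \<Rightarrow> real) \<Rightarrow> (nat \<Rightarrow> real poly) \<Rightarrow> bool" where
  "absorbable n p a b f \<longleftrightarrow> (\<exists>x u. \<forall>i<n. poly (x i) 0 = 0 \<and> poly (x i) 1 = 0 \<and>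
      f i = residual n a x i + (\<Sum>l<p. smult (b i l) (u l)))"

lemma absorbable_zero: "absorbable n p a b (\<lambda>i. 0)"
  unfolding absorbable_def
  by (rule exI[of _ "\<lambda>i. 0"], rule exI[of _ "\<lambda>i. 0"]) (simp add: residual_def)

lemma absorbable_add:
  assumes "absorbable n p a b f" "absorbable n p a b g"
  shows "absorbable n p a b (\<lambda>i. f i + g i)"
proof -
  obtain x u y v where
    "\<forall>i<n. poly (x i) 0 = 0 \<and> poly (x i) 1 = 0 \<and>
      f i = residual n a x i + (\<Sum>l<p. smult (b i l) (u l))"
    "\<forall>i<n. poly (y i) 0 = 0 \<and> poly (y i) 1 = 0 \<and>
      g i = residual n a y i + (\<Sum>l<p. smult (b i l) (v l))"
    using assms unfolding absorbable_def by blast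
  then show ?thesis
    unfolding absorbable_def
    by (intro exI[of _ "\<lambda>i. x i + y i"] exI[of _ "\<lambda>l. u l + v l"])
      (simp add: residual_add smult_add_right sum.distrib)
qed

lemma absorbable_sum:
  assumes "finite S" "\<And>s. s \<in> S \<Longrightarrow> absorbable n p a b (f s)"
  shows "absorbable n p a b (\<lambda>i. \<Sum>s\<in>S. f s i)"
  using assms
  by (induction S rule: finite_induct) (simp_all add: absorbable_zero absorbable_add)

lemma absorbable_cong:
  assumes "absorbable n p a b f" "\<And>i. i < n \<Longrightarrow> g i = f i"
  shows "absorbable n p a b g"
  using assms by (simp add: absorbable_def)

lemma dvd_pderiv_power:
  fixes q h :: "'a::idom poly"
  assumes "q ^ Suc k dvd h"
  shows "q ^ k dvd pderiv h"
proof -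
  obtain r where "h = q ^ Suc k * r" using assms by blast
  then have "pderiv h = q ^ k * (q * pderiv r + r * smult (of_nat (Suc k)) (pderiv q))"
    by (simp only: pderiv_mult pderiv_power_Suc) (simp add: algebra_simps)
  then show ?thesis by simp
qed

text \<open>
  By \<open>a\<^sup>k\<^sup>+\<^sup>1 b h = a\<^sup>k b h' - (d/dt - a)(a\<^sup>k b h)\<close>, one factor \<open>a\<close> is traded for one derivative of \<open>h\<close>,
  until only \<open>b\<close> times a derivative of \<open>h\<close> is left, which an input realises. Each trade changes
  the trajectory by a derivative of \<open>h\<close>, so \<open>h\<close> has to vanish at both ends to the order \<open>k\<close>.
\<close>

lemma absorbable_kalman:
  assumes "([:0, 1:] * [:-1, 1:]) ^ k dvd h" "l < p"
  shows "absorbable n p a b (\<lambda>i. smult (kalman n a b k i l) h)"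
  using assms
proof (induction k arbitrary: h)
  case 0
  have "(\<Sum>m<p. smult (b i m) (if m = l then h else 0)) = smult (b i l) h" for i
    using 0 by (simp add: if_distrib[of "smult _"] cong: if_cong)
  then show ?case
    unfolding absorbable_def
    by (intro exI[of _ "\<lambda>i. 0"] exI[of _ "\<lambda>m. if m = l then h else 0"]) (simp add: residual_def)
next
  case (Suc k)
  let ?K = "\<lambda>i. kalman n a b k i l"
  obtain r where r: "h = ([:0, 1:] * [:-1, 1:]) ^ Suc k * r" using Suc.prems by blast
  have ends: "poly h 0 = 0" "poly h 1 = 0" by (simp_all add: r)
  have "absorbable n p a b (\<lambda>i. smult (?K i) (pderiv h))"
    by (intro Suc dvd_pderiv_power)
  moreover have "absorbable n p a b (residual n a (\<lambda>i. smult (- ?K i) h))"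
    unfolding absorbable_def
    by (intro exI[of _ "\<lambda>i. smult (- ?K i) h"] exI[of _ "\<lambda>i. 0"]) (simp add: ends)
  ultimately have "absorbable n p a b
      (\<lambda>i. smult (?K i) (pderiv h) + residual n a (\<lambda>i. smult (- ?K i) h) i)"
    by (rule absorbable_add)
  then show ?case
    by (rule absorbable_cong)
      (simp add: residual_def pderiv_smult pderiv_minus sum_negf smult_sum)
qed

text \<open>
  If the Gramian \<open>W = K K\<^sup>T\<close> is invertible, then \<open>f = K (K\<^sup>T W\<^sup>-\<^sup>1 f)\<close> is a sum of terms \<open>a\<^sup>k b h\<close>
  with \<open>k < n\<close>, where \<open>h\<close> is as flat at the ends as \<open>f\<close>.
\<close>

lemma absorbable_if_flat:
  assumes det: "det (gramian n p a b) \<noteq> 0"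
    and flat: "\<And>i. i < n \<Longrightarrow> ([:0, 1:] * [:-1, 1:]) ^ n dvd f i"
  shows "absorbable n p a b f"
proof -
  let ?W = "gramian n p a b" and ?K = "kalman n a b"
  have W: "?W \<in> carrier_mat n n" by (simp add: gramian_def)
  obtain V where V: "V \<in> carrier_mat n n" "?W * V = 1\<^sub>m n"
    using det_non_zero_imp_unit[OF W det] by (auto simp: Units_def ring_mat_simps)
  \<comment> \<open>\<open>h = W\<^sup>-\<^sup>1 f\<close>, and \<open>g k\<close> is the \<open>k\<close>-th block of \<open>K\<^sup>T h\<close>.\<close>
  define h where "h j = (\<Sum>m<n. smult (V $$ (j, m)) (f m))" for j
  define g where "g k l = (\<Sum>j<n. smult (?K k j l) (h j))" for k l
  have dvd: "([:0, 1:] * [:-1, 1:]) ^ k dvd g k l" if "k < n" for k l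
    unfolding g_def h_def using that flat
    by (intro dvd_sum dvd_smult) (meson dvd_trans le_imp_power_dvd lessThan_iff less_imp_le)
  have "absorbable n p a b (\<lambda>i. \<Sum>k<n. \<Sum>l<p. smult (?K k i l) (g k l))"
    by (intro absorbable_sum absorbable_kalman dvd) auto
  moreover have "f i = (\<Sum>k<n. \<Sum>l<p. smult (?K k i l) (g k l))" if i: "i < n" for i
  proof -
    have "(\<Sum>k<n. \<Sum>l<p. smult (?K k i l) (g k l)) =
        (\<Sum>j<n. \<Sum>k<n. \<Sum>l<p. smult (?K k i l * ?K k j l) (h j))"
      unfolding g_def smult_sum_right smult_smult
      by (subst sum.swap[of _ "{..<n}" "{..<p}"], rule sum.swap)
    also have "\<dots> = (\<Sum>j<n. smult (?W $$ (i, j)) (h j))"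
      using i by (simp add: gramian_def smult_sum)
    also have "\<dots> = (\<Sum>m<n. smult (\<Sum>j<n. ?W $$ (i, j) * V $$ (j, m)) (f m))"
      unfolding h_def smult_sum_right smult_smult smult_sum by (rule sum.swap)
    also have "\<dots> = (\<Sum>m<n. smult ((?W * V) $$ (i, m)) (f m))"
      using i W V(1) by (intro sum.cong refl) (auto simp: scalar_prod_def atLeast0LessThan)
    also have "\<dots> = f i"
      using i by (simp add: V(2) if_distrib[of "\<lambda>c. smult c _"] cong: if_cong)
    finally show ?thesis by simp
  qed
  ultimately show ?thesis
    by (rule absorbable_cong)
qed

text \<open>
  A polynomial that agrees to high order at \<open>c\<close> with the free motion starting in \<open>v\<close> at time \<open>c\<close>.
  It is corrected order by order: the leading term of the residual is integrated and subtracted.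
\<close>

lemma jet_exists:
  "\<exists>x. \<forall>i<n. poly (x i) c = v i \<and> [:-c, 1:] ^ m dvd residual n a x i"
proof (induction m)
  case 0
  show ?case by (rule exI[of _ "\<lambda>i. [:v i:]"]) simp
next
  case (Suc m)
  let ?q = "[:-c, 1:] :: real poly"
  obtain x where x: "\<forall>i<n. poly (x i) c = v i \<and> ?q ^ m dvd residual n a x i"
    using Suc by blast
  then have "\<forall>i. \<exists>r. i < n \<longrightarrow> residual n a x i = ?q ^ m * r"
    by (meson dvdE)
  then obtain r where r: "\<And>i. i < n \<Longrightarrow> residual n a x i = ?q ^ m * r i"
    by metis
  \<comment> \<open>The antiderivative of \<open>?q ^ m\<close> that vanishes at \<open>c\<close>.\<close>
  define e where "e = smult (1 / real (Suc m)) (?q ^ Suc m)"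
  have e: "pderiv e = ?q ^ m"
    by (simp add: e_def pderiv_smult pderiv_power_Suc pderiv_pCons del: power_Suc of_nat_Suc)
  show ?case
  proof (rule exI[of _ "\<lambda>i. x i - e * r i"], intro allI impI conjI)
    fix i assume i: "i < n"
    show "poly (x i - e * r i) c = v i"
      using x i by (simp add: e_def)
    have "residual n a (\<lambda>i. x i - e * r i) i = - e * residual n a r i"
      using r[OF i] by (simp add: residual_diff residual_mult e)
    moreover have "?q ^ Suc m dvd e"
      unfolding e_def by (rule dvd_smult) simp
    ultimately show "?q ^ Suc m dvd residual n a (\<lambda>i. x i - e * r i) i"
      by (simp add: dvd_mult2 del: power_Suc)
  qed
qed

text \<open>
  The free motions from \<open>v\<close> at time 0 and into \<open>w\<close> at time 1 are blended by a weight that is flat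
  at both ends. There, the blended curve is an almost free motion, so its residual is flat.
\<close>

lemma joining_exists:
  fixes v w :: "nat \<Rightarrow> real"
  shows "\<exists>x. \<forall>i<n. poly (x i) 0 = v i \<and> poly (x i) 1 = w i \<and>
    ([:0, 1:] * [:-1, 1:]) ^ m dvd residual n a x i"
proof -
  let ?s = "[:0, 1:] :: real poly" and ?t = "[:-1, 1:] :: real poly"
  obtain x where x: "\<And>i. i < n \<Longrightarrow> poly (x i) 0 = v i"
      "\<And>i. i < n \<Longrightarrow> ?s ^ m dvd residual n a x i"
    using jet_exists[of n 0 v m a] by auto
  obtain y where y: "\<And>i. i < n \<Longrightarrow> poly (y i) 1 = w i"
      "\<And>i. i < n \<Longrightarrow> ?t ^ m dvd residual n a y i"
    using jet_exists[of n 1 w m a] by auto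
  have cop: "coprime ?s ?t"
  proof (rule coprimeI)
    fix d assume "d dvd ?s" "d dvd ?t"
    then have "d dvd ?s - ?t" by (rule dvd_diff)
    then show "is_unit d" by (simp add: one_pCons)
  qed
  then have "coprime (?s ^ Suc m) (?t ^ Suc m)"
    by (simp only: coprime_power_left_iff coprime_power_right_iff simp_thms)
  then obtain f g where fg: "f * ?s ^ Suc m + g * ?t ^ Suc m = 1"
    using bezout_coefficients_fst_snd[of "?s ^ Suc m" "?t ^ Suc m"]
    unfolding coprime_iff_gcd_eq_1 by metis
  \<comment> \<open>The weight is 1 to the order \<open>m\<close> at time 0 and 0 to that order at time 1.\<close>
  define \<phi> where "\<phi> = g * ?t ^ Suc m"
  have \<phi>: "1 - \<phi> = f * ?s ^ Suc m" using fg by (simp add: \<phi>_def algebra_simps)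
  have \<phi>0: "?t ^ Suc m dvd \<phi>" "?s ^ Suc m dvd 1 - \<phi>"
    unfolding \<phi> by (simp_all only: \<phi>_def dvd_triv_right)
  have "?t ^ m dvd pderiv \<phi>" "?s ^ m dvd pderiv (1 - \<phi>)"
    by (rule \<phi>0[THEN dvd_pderiv_power])+
  then have d\<phi>: "?t ^ m dvd pderiv \<phi>" "?s ^ m dvd pderiv \<phi>"
    by (simp_all add: pderiv_diff)
  have "poly (1 - \<phi>) 0 = 0" unfolding \<phi> by simp
  then have ends: "poly \<phi> 0 = 1" "poly \<phi> 1 = 0"
    by simp (simp add: \<phi>_def)
  have div: "(?s * ?t) ^ m dvd h" if "?s ^ m dvd h" "?t ^ m dvd h" for h
    unfolding power_mult_distrib using that cop by (intro divides_mult) auto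
  show ?thesis
  proof (rule exI[of _ "\<lambda>i. \<phi> * x i + (1 - \<phi>) * y i"], intro allI impI conjI)
    fix i assume i: "i < n"
    show "poly (\<phi> * x i + (1 - \<phi>) * y i) 0 = v i" "poly (\<phi> * x i + (1 - \<phi>) * y i) 1 = w i"
      using x(1)[OF i] y(1)[OF i] by (simp_all add: ends)
    have *: "residual n a (\<lambda>i. \<phi> * x i + (1 - \<phi>) * y i) i =
        pderiv \<phi> * (x i - y i) + \<phi> * residual n a x i + (1 - \<phi>) * residual n a y i"
      unfolding residual_add residual_mult by (simp add: pderiv_diff algebra_simps)
    have \<phi>m: "?t ^ m dvd \<phi>" "?s ^ m dvd 1 - \<phi>"
      using \<phi>0 by (meson dvd_trans le_imp_power_dvd le_SucI order_refl)+
    show "(?s * ?t) ^ m dvd residual n a (\<lambda>i. \<phi> * x i + (1 - \<phi>) * y i) i"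
      unfolding *
      by (intro div dvd_add; (rule dvd_mult2 dvd_mult; rule d\<phi> \<phi>m x(2)[OF i] y(2)[OF i])+)
  qed
qed

text \<open>
  Kalman's criterion: join the given states by a curve with flat residual and absorb this residual.
\<close>

lemma controllable_if_det_gramian:
  assumes M: "M \<in> carrier_mat n n" and N: "N \<in> carrier_mat n p"
    and det: "det (gramian n p (\<lambda>i j. M $$ (i, j)) (\<lambda>i l. N $$ (i, l))) \<noteq> 0"
  shows "controllable M N"
  unfolding controllable_def
proof (intro ballI)
  let ?a = "\<lambda>i j. M $$ (i, j)" and ?b = "\<lambda>i l. N $$ (i, l)"
  have dims [simp]: "dim_row M = n" "dim_col M = n" "dim_row N = n" "dim_col N = p"
    using M N by auto
  fix x\<^sub>0 x\<^sub>1 :: "real vec"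
  assume x01: "x\<^sub>0 \<in> carrier_vec (dim_row M)" "x\<^sub>1 \<in> carrier_vec (dim_row M)"
  obtain g where g: "\<And>i. i < n \<Longrightarrow> poly (g i) 0 = x\<^sub>0 $ i" "\<And>i. i < n \<Longrightarrow> poly (g i) 1 = x\<^sub>1 $ i"
      "\<And>i. i < n \<Longrightarrow> ([:0, 1:] * [:-1, 1:]) ^ n dvd residual n ?a g i"
    using joining_exists[of n "\<lambda>i. x\<^sub>0 $ i" "\<lambda>i. x\<^sub>1 $ i" n ?a] by auto
  obtain y u where y: "\<And>i. i < n \<Longrightarrow> poly (y i) 0 = 0" "\<And>i. i < n \<Longrightarrow> poly (y i) 1 = 0"
      and yu: "\<And>i. i < n \<Longrightarrow> residual n ?a g i = residual n ?a y i + (\<Sum>l<p. smult (?b i l) (u l))"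
    using absorbable_if_flat[OF det, of "residual n ?a g"] g(3) unfolding absorbable_def by blast
  define x where "x i = g i - y i" for i
  have x: "pderiv (x i) = (\<Sum>j<n. smult (?a i j) (x j)) + (\<Sum>l<p. smult (?b i l) (u l))"
    if "i < n" for i
  proof -
    have "residual n ?a x i = (\<Sum>l<p. smult (?b i l) (u l))"
      unfolding x_def residual_diff yu[OF that] by simp
    then show ?thesis by (simp add: residual_def algebra_simps)
  qed
  have ode: "(M *\<^sub>v vec n (\<lambda>i. poly (x i) t) + N *\<^sub>v vec p (\<lambda>l. poly (u l) t)) $ k = poly (pderiv (x k)) t"
    if "k < n" for k t
    using that M N unfolding x[OF that]
    by (simp add: scalar_prod_def poly_sum atLeast0LessThan)
  let ?x = "\<lambda>t. vec n (\<lambda>i. poly (x i) t)" and ?u = "\<lambda>t. vec p (\<lambda>l. poly (u l) t)"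
  have "((\<lambda>s. ?x s $ k) has_real_derivative (M *\<^sub>v ?x t + N *\<^sub>v ?u t) $ k) (at t within S)"
    if "k < n" for k t S
    unfolding ode[OF that] using that by (simp add: DERIV_subset[OF poly_DERIV])
  moreover have "?x 0 = x\<^sub>0" "?x 1 = x\<^sub>1"
    using x01 by (auto simp: x_def g y)
  moreover have "continuous_on S (\<lambda>t. ?u t $ k)" if "k < p" for k S
    using that by (auto intro!: continuous_intros)
  ultimately show "\<exists>T>0. \<exists>u x.
      (\<forall>t\<in>{0..T}. u t \<in> carrier_vec (dim_col N) \<and> x t \<in> carrier_vec (dim_row M)) \<and>
      (\<forall>k<dim_col N. continuous_on {0..T} (\<lambda>t. u t $ k)) \<and>
      (\<forall>t\<in>{0..T}. \<forall>k<dim_row M.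
        ((\<lambda>s. x s $ k) has_real_derivative (M *\<^sub>v x t + N *\<^sub>v u t) $ k) (at t within {0..T})) \<and>
      x 0 = x\<^sub>0 \<and> x T = x\<^sub>1"
    by (intro exI[of _ "1 :: real"] conjI exI[of _ ?u] exI[of _ ?x]) simp_all
qed

section \<open>Left eigenvectors hidden from the inputs\<close>

text \<open>
  The transpose of \<open>a\<close>, acting on complex vectors: its eigenvectors are the left eigenvectors of \<open>a\<close>.
\<close>

definition adjoint_action :: "nat \<Rightarrow> (nat \<Rightarrow> nat \<Rightarrow> real) \<Rightarrow> (nat \<Rightarrow> complex) \<Rightarrow> nat \<Rightarrow> complex" where
  "adjoint_action n a v j = (\<Sum>i<n. of_real (a i j) * v i)"

text \<open>
  \<open>q(a\<^sup>T) v\<close>.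
\<close>

definition poly_action ::
    "nat \<Rightarrow> (nat \<Rightarrow> nat \<Rightarrow> real) \<Rightarrow> complex poly \<Rightarrow> (nat \<Rightarrow> complex) \<Rightarrow> nat \<Rightarrow> complex" where
  "poly_action n a q v i = (\<Sum>t\<le>degree q. coeff q t * (adjoint_action n a ^^ t) v i)"

lemma poly_action_altdef:
  assumes "degree q \<le> m"
  shows "poly_action n a q v i = (\<Sum>t\<le>m. coeff q t * (adjoint_action n a ^^ t) v i)"
  unfolding poly_action_def
  by (rule sum.mono_neutral_left) (use assms in \<open>auto simp: coeff_eq_0\<close>)

lemma adjoint_action_poly_action:
  "adjoint_action n a (poly_action n a q v) i =
    (\<Sum>t\<le>degree q. coeff q t * (adjoint_action n a ^^ Suc t) v i)"
  unfolding poly_action_def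
  by (simp add: adjoint_action_def sum_distrib_left sum_distrib_right)
    (subst sum.swap, simp add: mult_ac)

lemma poly_action_linear_factor:
  "poly_action n a ([:- c, 1:] * q) v i =
    adjoint_action n a (poly_action n a q v) i - c * poly_action n a q v i"
proof -
  let ?T = "adjoint_action n a" and ?m = "degree q"
  have split: "[:- c, 1:] * q = pCons 0 q - smult c q" by simp
  have deg: "degree ([:- c, 1:] * q) \<le> Suc ?m"
    using degree_mult_le[of "[:- c, 1:]" q] by simp
  have "poly_action n a ([:- c, 1:] * q) v i =
      (\<Sum>t\<le>Suc ?m. coeff (pCons 0 q) t * (?T ^^ t) v i) - c * (\<Sum>t\<le>Suc ?m. coeff q t * (?T ^^ t) v i)"
    by (subst poly_action_altdef[OF deg], subst split)
      (simp only: coeff_diff coeff_smult left_diff_distrib sum_subtractf mult.assoc sum_distrib_left)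
  also have "(\<Sum>t\<le>Suc ?m. coeff q t * (?T ^^ t) v i) = poly_action n a q v i"
    by (rule poly_action_altdef[symmetric]) simp
  also have "(\<Sum>t\<le>Suc ?m. coeff (pCons 0 q) t * (?T ^^ t) v i) = ?T (poly_action n a q v) i"
    by (subst sum.atMost_Suc_shift) (simp add: adjoint_action_poly_action)
  finally show ?thesis .
qed

text \<open>
  The \<open>n + 1\<close> vectors \<open>v, a\<^sup>T v, \<dots>, (a\<^sup>T)\<^sup>n v\<close> are linearly dependent, since a zero row makes them the
  columns of a singular square matrix.
\<close>

lemma annihilating_poly_exists:
  "\<exists>q. q \<noteq> 0 \<and> degree q \<le> n \<and> (\<forall>i<n. poly_action n a q v i = 0)"
proof -
  define K where
    "K = mat (Suc n) (Suc n) (\<lambda>(i, t). if i < n then (adjoint_action n a ^^ t) v i else 0)"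
  have K: "K \<in> carrier_mat (Suc n) (Suc n)" by (simp add: K_def)
  have "det K = det (mat\<^sub>r (Suc n) (Suc n) (\<lambda>i. if i = n then 0\<^sub>v (Suc n) else row K i))"
    by (rule arg_cong[of _ _ det]) (auto simp: K_def intro!: eq_matI)
  also have "\<dots> = 0"
    by (rule det_row_0) (auto simp: K_def)
  finally have "det K = 0" .
  then obtain w where w: "w \<in> carrier_vec (Suc n)" "w \<noteq> 0\<^sub>v (Suc n)" "K *\<^sub>v w = 0\<^sub>v (Suc n)"
    using det_0_iff_vec_prod_zero[OF K] by blast
  define q where "q = (\<Sum>t\<le>n. monom (w $ t) t)"
  have coeff: "coeff q t = (if t \<le> n then w $ t else 0)" for t
    by (auto simp: q_def coeff_sum coeff_monom)
  have deg: "degree q \<le> n"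
    by (rule degree_le) (simp add: coeff)
  have "q \<noteq> 0"
  proof
    assume "q = 0"
    then have "w $ t = 0" if "t \<le> n" for t
      using coeff[of t] that by simp
    then show False
      using w(1, 2) by (auto intro!: eq_vecI simp: less_Suc_eq_le)
  qed
  moreover have "poly_action n a q v i = 0" if i: "i < n" for i
  proof -
    have "poly_action n a q v i = (K *\<^sub>v w) $ i"
      using i w(1) by (simp add: poly_action_altdef[OF deg] coeff K_def scalar_prod_def
          atLeast0LessThan lessThan_Suc_atMost mult.commute)
    then show ?thesis using i by (simp add: w(3))
  qed
  ultimately show ?thesis using deg by blast
qed

text \<open>
  Split a linear factor off a nonzero polynomial of least degree that annihilates \<open>v\<close>: the quotient
  does not annihilate \<open>v\<close>, and it maps \<open>v\<close> to an eigenvector. The degree bound puts this eigenvector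
  into the span of \<open>v, \<dots>, (a\<^sup>T)\<^sup>n\<^sup>-\<^sup>1 v\<close>, on which only finitely many orthogonality conditions are known.
\<close>

lemma eigenvector_in_cyclic_span:
  assumes v: "\<exists>i<n. v i \<noteq> 0"
  shows "\<exists>q c. degree q < n \<and> (\<exists>i<n. poly_action n a q v i \<noteq> 0) \<and>
    (\<forall>i<n. adjoint_action n a (poly_action n a q v) i = c * poly_action n a q v i)"
proof -
  let ?ann = "\<lambda>q. q \<noteq> 0 \<and> (\<forall>i<n. poly_action n a q v i = 0)"
  obtain q0 where q0: "?ann q0" "degree q0 \<le> n" using annihilating_poly_exists by blast
  obtain q where q: "?ann q" and min: "\<And>q'. ?ann q' \<Longrightarrow> degree q \<le> degree q'"
    using ex_has_least_nat[of ?ann q0 degree] q0(1) by blast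
  have "degree q \<noteq> 0"
  proof
    assume "degree q = 0"
    then obtain d where "q = [:d:]" by (rule degree_eq_zeroE)
    then show False using q v by (auto simp: poly_action_def)
  qed
  then obtain c where "poly q c = 0"
    using fundamental_theorem_of_algebra constant_degree by metis
  then obtain s where s: "q = [:- c, 1:] * s"
    using poly_eq_0_iff_dvd by blast
  with q have "s \<noteq> 0" by auto
  then have deg: "degree q = Suc (degree s)"
    unfolding s by (subst degree_mult_eq) auto
  have "\<not> ?ann s" using min[of s] deg by auto
  then have "\<exists>i<n. poly_action n a s v i \<noteq> 0" using \<open>s \<noteq> 0\<close> by blast
  moreover have "\<forall>i<n. adjoint_action n a (poly_action n a s v) i = c * poly_action n a s v i"
    using q unfolding s poly_action_linear_factor by simp
  moreover have "degree s < n" using min[OF q0(1)] q0(2) deg by simp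
  ultimately show ?thesis by blast
qed

lemma kalman_pairing:
  "(\<Sum>i<n. of_real (kalman n a b k i l) * v i) =
    (\<Sum>i<n. of_real (b i l) * (adjoint_action n a ^^ k) v i)"
proof (induction k arbitrary: v)
  case (Suc k)
  have "(\<Sum>i<n. of_real (kalman n a b (Suc k) i l) * v i) =
      (\<Sum>j<n. of_real (kalman n a b k j l) * adjoint_action n a v j)"
    by (simp add: adjoint_action_def sum_distrib_left sum_distrib_right)
      (subst sum.swap, simp add: mult_ac)
  then show ?case by (simp only: Suc funpow_Suc_right comp_apply)
qed simp

text \<open>
  The Popov-Belevitch-Hautus test. A kernel vector \<open>v\<close> of \<open>K K\<^sup>T\<close> satisfies \<open>|K\<^sup>T v|\<^sup>2 = 0\<close>, so
  \<open>b\<^sup>T (a\<^sup>T)\<^sup>k v = 0\<close> for all \<open>k < n\<close>. Then \<open>b\<^sup>T\<close> vanishes on the cyclic span of \<open>v\<close>, in particular on an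
  eigenvector in this span.
\<close>

lemma det_gramian_if_no_hidden_eigenvector:
  assumes pbh: "\<And>w c. \<lbrakk>\<And>i. i < n \<Longrightarrow> adjoint_action n a w i = c * w i;
      \<And>l. l < p \<Longrightarrow> (\<Sum>i<n. of_real (b i l) * w i) = 0\<rbrakk> \<Longrightarrow> \<forall>i<n. w i = 0"
  shows "det (gramian n p a b) \<noteq> 0"
proof
  let ?W = "gramian n p a b" and ?K = "kalman n a b"
  assume "det ?W = 0"
  moreover have W: "?W \<in> carrier_mat n n" by (simp add: gramian_def)
  ultimately obtain v where v: "v \<in> carrier_vec n" "v \<noteq> 0\<^sub>v n" "?W *\<^sub>v v = 0\<^sub>v n"
    using det_0_iff_vec_prod_zero by blast
  have "(\<Sum>k<n. \<Sum>l<p. (\<Sum>i<n. ?K k i l * v $ i)\<^sup>2) = v \<bullet> (?W *\<^sub>v v)"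
  proof -
    have "(\<Sum>k<n. \<Sum>l<p. (\<Sum>i<n. ?K k i l * v $ i)\<^sup>2) =
        (\<Sum>k<n. \<Sum>l<p. \<Sum>i<n. \<Sum>j<n. v $ i * (?K k i l * ?K k j l) * v $ j)"
      by (simp add: power2_eq_square sum_product mult_ac)
    also have "\<dots> = (\<Sum>k<n. \<Sum>i<n. \<Sum>j<n. \<Sum>l<p. v $ i * (?K k i l * ?K k j l) * v $ j)"
      by (rule sum.cong[OF refl], rule trans[OF sum.swap], rule sum.cong[OF refl], rule sum.swap)
    also have "\<dots> = (\<Sum>i<n. \<Sum>j<n. \<Sum>k<n. \<Sum>l<p. v $ i * (?K k i l * ?K k j l) * v $ j)"
      by (rule trans[OF sum.swap], rule sum.cong[OF refl], rule sum.swap)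
    also have "\<dots> = (\<Sum>i<n. \<Sum>j<n. v $ i * ?W $$ (i, j) * v $ j)"
      by (intro sum.cong refl) (simp add: gramian_def sum_distrib_left sum_distrib_right)
    also have "\<dots> = v \<bullet> (?W *\<^sub>v v)"
      using v(1) W by (simp add: scalar_prod_def atLeast0LessThan sum_distrib_left mult.assoc)
    finally show ?thesis .
  qed
  also have "\<dots> = 0" using v by simp
  finally have "(\<Sum>i<n. ?K k i l * v $ i) = 0" if "k < n" "l < p" for k l
    using that by (simp add: sum_nonneg_eq_0_iff sum_nonneg)
  then have "(\<Sum>i<n. of_real (?K k i l) * complex_of_real (v $ i)) = 0" if "k < n" "l < p" for k l
    using that by (simp flip: of_real_mult of_real_sum)
  then have orth: "(\<Sum>i<n. of_real (b i l) * (adjoint_action n a ^^ k) (\<lambda>i. of_real (v $ i)) i) = 0"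
    if "k < n" "l < p" for k l
    using that by (simp add: kalman_pairing)
  have "\<exists>i<n. complex_of_real (v $ i) \<noteq> 0"
    using v(1, 2) by (auto intro!: eq_vecI)
  from eigenvector_in_cyclic_span[OF this, of a] obtain q c where q: "degree q < n"
      and nz: "\<exists>i<n. poly_action n a q (\<lambda>i. of_real (v $ i)) i \<noteq> 0"
      and eig: "\<forall>i<n. adjoint_action n a (poly_action n a q (\<lambda>i. of_real (v $ i))) i =
        c * poly_action n a q (\<lambda>i. of_real (v $ i)) i"
    by blast
  have "(\<Sum>i<n. of_real (b i l) * poly_action n a q (\<lambda>i. of_real (v $ i)) i) = 0" if "l < p" for l
  proof -
    have "(\<Sum>i<n. of_real (b i l) * poly_action n a q (\<lambda>i. of_real (v $ i)) i) =
        (\<Sum>t\<le>degree q. coeff q t *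
          (\<Sum>i<n. of_real (b i l) * (adjoint_action n a ^^ t) (\<lambda>i. of_real (v $ i)) i))"
      unfolding poly_action_def sum_distrib_left by (subst sum.swap) (simp add: mult_ac)
    also have "\<dots> = 0" using orth q that by simp
    finally show ?thesis .
  qed
  with pbh eig nz show False by blast
qed

section \<open>Perturbation within a sparsity pattern\<close>

lemma continuous_det:
  fixes f :: "nat \<Rightarrow> nat \<Rightarrow> real \<Rightarrow> real"
  assumes "\<And>i j. i < n \<Longrightarrow> j < n \<Longrightarrow> continuous_on S (f i j)"
  shows "continuous_on S (\<lambda>t. det (mat n n (\<lambda>(i, j). f i j t)))"
proof -
  have "det (mat n n (\<lambda>(i, j). f i j t)) =
      (\<Sum>\<pi> | \<pi> permutes {0..<n}. signof \<pi> * (\<Prod>i = 0..<n. f i (\<pi> i) t))" for t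
    by (subst det_def') (auto intro!: sum.cong prod.cong simp: permutes_in_image)
  moreover have "continuous_on S (\<lambda>t. \<Sum>\<pi> | \<pi> permutes {0..<n}. signof \<pi> * (\<Prod>i = 0..<n. f i (\<pi> i) t))"
    by (intro continuous_intros assms) (auto simp: permutes_in_image)
  ultimately show ?thesis by presburger
qed

lemma continuous_det_gramian:
  fixes S :: "real set"
  assumes "\<And>i j. continuous_on S (\<lambda>t. a t i j)" "\<And>i l. continuous_on S (\<lambda>t. b t i l)"
  shows "continuous_on S (\<lambda>t. det (gramian n p (a t) (b t)))"
proof -
  have kalman: "continuous_on S (\<lambda>t. kalman n (a t) (b t) k i l)" for k i l
    by (induction k arbitrary: i) (auto intro!: continuous_intros assms)
  show ?thesis
    unfolding gramian_def
    by (rule continuous_det[where f = "\<lambda>i j t. \<Sum>k<n. \<Sum>l<p.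
        kalman n (a t) (b t) k i l * kalman n (a t) (b t) k j l"])
      (intro continuous_intros kalman)
qed

text \<open>
  It suffices to find a controllable pair whose pattern is contained in the given one. Adding a
  small \<open>t > 0\<close> to all entries of the pattern keeps the determinant of the Gramian nonzero, and,
  as the entries are nonnegative, cannot cancel any of them.
\<close>

lemma structurally_controllable_if_subpattern:
  fixes a b :: "nat \<Rightarrow> nat \<Rightarrow> real"
  assumes M: "M \<in> carrier_mat n n" and N: "N \<in> carrier_mat n p"
    and a: "\<And>i j. i < n \<Longrightarrow> j < n \<Longrightarrow> 0 \<le> a i j \<and> (M $$ (i, j) = 0 \<longrightarrow> a i j = 0)"
    and b: "\<And>i l. i < n \<Longrightarrow> l < p \<Longrightarrow> 0 \<le> b i l \<and> (N $$ (i, l) = 0 \<longrightarrow> b i l = 0)"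
    and det: "det (gramian n p a b) \<noteq> 0"
  shows "structurally_controllable M N"
proof -
  define a' b' where "a' t i j = a i j + t * (if M $$ (i, j) = 0 then 0 else 1)"
    and "b' t i l = b i l + t * (if N $$ (i, l) = 0 then 0 else 1)" for t i j l
  have "continuous_on UNIV (\<lambda>t. det (gramian n p (a' t) (b' t)))"
    by (intro continuous_det_gramian) (auto simp: a'_def b'_def intro!: continuous_intros)
  then have "isCont (\<lambda>t. det (gramian n p (a' t) (b' t))) 0"
    by (simp add: continuous_on_eq_continuous_at)
  moreover have "det (gramian n p (a' 0) (b' 0)) \<noteq> 0"
    using det by (simp add: a'_def[abs_def] b'_def[abs_def])
  ultimately have "\<forall>\<^sub>F t in at 0. det (gramian n p (a' t) (b' t)) \<noteq> 0"
    by (simp add: isCont_def tendsto_imp_eventually_ne)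
  then obtain d where d: "d > 0" "\<And>t. t \<noteq> 0 \<Longrightarrow> dist t 0 < d \<Longrightarrow> det (gramian n p (a' t) (b' t)) \<noteq> 0"
    unfolding eventually_at by auto
  define t where "t = d / 2"
  have t: "t > 0" "det (gramian n p (a' t) (b' t)) \<noteq> 0"
    using d by (auto simp: t_def)
  define M\<^sub>t N\<^sub>t where "M\<^sub>t = mat n n (\<lambda>(i, j). a' t i j)" and "N\<^sub>t = mat n p (\<lambda>(i, l). b' t i l)"
  have "kalman n (\<lambda>i j. M\<^sub>t $$ (i, j)) (\<lambda>i l. N\<^sub>t $$ (i, l)) k i l = kalman n (a' t) (b' t) k i l"
    if "i < n" "l < p" for k i l
    using that by (induction k arbitrary: i) (simp_all add: M\<^sub>t_def N\<^sub>t_def)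
  then have "gramian n p (\<lambda>i j. M\<^sub>t $$ (i, j)) (\<lambda>i l. N\<^sub>t $$ (i, l)) = gramian n p (a' t) (b' t)"
    by (auto simp: gramian_def intro!: eq_matI)
  then have "controllable M\<^sub>t N\<^sub>t"
    using t(2) by (intro controllable_if_det_gramian) (auto simp: M\<^sub>t_def N\<^sub>t_def)
  moreover have "same_pattern M\<^sub>t M" "same_pattern N\<^sub>t N"
    using M N a b t(1)
    by (fastforce simp: same_pattern_def M\<^sub>t_def N\<^sub>t_def a'_def b'_def add_nonneg_eq_0_iff)+
  ultimately show ?thesis unfolding structurally_controllable_def by blast
qed

section \<open>Cycles that form a forest\<close>

text \<open>
  The disjoint cycles of \<open>\<sigma>\<close> contain all states. Each cycle is named by one of its states,
  its \<open>entry\<close>, through which it receives a single edge: from an input, or from a state of another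
  cycle whose entry has smaller depth. So the cycles form a forest that hangs from the inputs.
\<close>

locale rooted_cycles =
  fixes n :: nat and \<sigma> :: "nat \<Rightarrow> nat" and entry :: "nat \<Rightarrow> nat"
    and source :: "nat \<Rightarrow> vertex" and depth :: "nat \<Rightarrow> nat"
  assumes permutes: "\<sigma> permutes {..<n}"
    and entry_less: "k < n \<Longrightarrow> entry k < n"
    and entry_step: "k < n \<Longrightarrow> entry (\<sigma> k) = entry k"
    and entry_entry: "k < n \<Longrightarrow> entry (entry k) = entry k"
    and same_cycle: "k < n \<Longrightarrow> l < n \<Longrightarrow> entry k = entry l \<Longrightarrow> l \<in> orbit \<sigma> k"
    and source_above: "e < n \<Longrightarrow> source e = State q \<Longrightarrow> q < n \<and> depth (entry q) < depth e"
begin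

text \<open>
  All edges of a cycle have the same weight, and distinct cycles have distinct weights; the edges
  between cycles have weight 1. By itself, a cycle of weight \<open>\<alpha>\<close> has only eigenvalues of modulus \<open>\<alpha>\<close>,
  hence no two cycles share an eigenvalue. One is added to the entry since a weight 0 would remove
  the edge.
\<close>

definition cycle_weight :: "nat \<Rightarrow> nat \<Rightarrow> real" where
  "cycle_weight i k = (if i = \<sigma> k then real (Suc (entry k)) else 0) +
    (if entry i = i \<and> source i = State k then 1 else 0)"

definition input_weight :: "nat \<Rightarrow> nat \<Rightarrow> real" where
  "input_weight i l = (if entry i = i \<and> source i = Input l then 1 else 0)"

text \<open>
  What the cycles hanging from the vertex \<open>v\<close> contribute to the eigenvector equation at \<open>v\<close>.
\<close>

definition branch :: "(nat \<Rightarrow> complex) \<Rightarrow> vertex \<Rightarrow> complex" where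
  "branch w v = (\<Sum>i | i < n \<and> entry i = i \<and> source i = v. w i)"

text \<open>
  A cycle that hangs from an input is its own parent, so \<open>parent\<close> is total and its iterates
  become constant at the root of the tree.
\<close>

definition parent :: "nat \<Rightarrow> nat" where
  "parent e = (case source e of State q \<Rightarrow> entry q | Input l \<Rightarrow> e)"

lemma step_less: "k < n \<Longrightarrow> \<sigma> k < n"
  using permutes_in_image[OF permutes, of k] by simp

lemma adjoint_cycle_weight:
  assumes "k < n"
  shows "adjoint_action n cycle_weight w k = of_nat (Suc (entry k)) * w (\<sigma> k) + branch w (State k)"
proof -
  have "adjoint_action n cycle_weight w k =
      (\<Sum>i<n. (if i = \<sigma> k then of_nat (Suc (entry k)) * w i else 0) +
        (if entry i = i \<and> source i = State k then w i else 0))"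
    unfolding adjoint_action_def cycle_weight_def by (intro sum.cong) (auto simp: algebra_simps)
  also have "\<dots> = of_nat (Suc (entry k)) * w (\<sigma> k) + branch w (State k)"
    using step_less[OF assms]
    by (simp add: sum.distrib branch_def sum.If_cases Int_def lessThan_def del: of_nat_Suc)
  finally show ?thesis .
qed

lemma input_weight_sum: "(\<Sum>i<n. of_real (input_weight i l) * w i) = branch w (Input l)"
proof -
  have "(\<Sum>i<n. of_real (input_weight i l) * w i) =
      (\<Sum>i<n. if entry i = i \<and> source i = Input l then w i else 0)"
    by (intro sum.cong) (auto simp: input_weight_def)
  then show ?thesis by (simp add: branch_def sum.If_cases Int_def lessThan_def)
qed

lemma depth_parent:
  "e < n \<Longrightarrow> entry e = e \<Longrightarrow> parent e < n \<and> entry (parent e) = parent e \<and> depth (parent e) \<le> depth e"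
  using source_above[of e] entry_less entry_entry
  by (auto simp: parent_def less_imp_le split: vertex.split)

lemma depth_funpow_parent:
  assumes "e < n" "entry e = e"
  shows "(parent ^^ i) e < n \<and> entry ((parent ^^ i) e) = (parent ^^ i) e \<and> depth ((parent ^^ i) e) \<le> depth e"
proof (induction i)
  case (Suc i)
  then show ?case
    using depth_parent[of "(parent ^^ i) e"] by auto
qed (use assms in auto)

text \<open>
  If two distinct members of the chain of ancestors of \<open>e\<close> had the same parent, then the higher one
  would be this parent or one of its ancestors, although a parent is less deep than its children.
\<close>

lemma ancestors_with_same_parent:
  assumes e: "e < n" "entry e = e"
    and src: "source ((parent ^^ i) e) = State q" "source ((parent ^^ j) e) = State q'" "entry q = entry q'"
  shows "(parent ^^ i) e = (parent ^^ j) e"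
proof -
  have no: False
    if "i < j" "source ((parent ^^ i) e) = State q" "source ((parent ^^ j) e) = State q'" "entry q = entry q'"
    for i j q q'
  proof -
    obtain m where "j = m + Suc i"
      using \<open>i < j\<close> by (metis add.commute less_iff_Suc_add add_Suc_right)
    then have j: "(parent ^^ j) e = (parent ^^ m) (parent ((parent ^^ i) e))"
      by (simp add: funpow_add funpow_swap1)
    have p: "parent ((parent ^^ i) e) = entry q" "parent ((parent ^^ j) e) = entry q'"
      using that by (simp_all add: parent_def)
    have *: "(parent ^^ i) e < n" "(parent ^^ j) e < n"
      using depth_funpow_parent[OF e] by blast+
    have "depth (entry q') < depth ((parent ^^ j) e)"
      using source_above[OF *(2) that(3)] by simp
    moreover have "depth ((parent ^^ j) e) \<le> depth (entry q)"
      unfolding j p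
      using source_above[OF *(1) that(2)] depth_funpow_parent[of "entry q" m] entry_less entry_entry
      by blast
    ultimately show False using that(4) by simp
  qed
  then show ?thesis
    using no[of i j q q'] no[of j i q' q] src by (metis linorder_neqE_nat)
qed

lemma ancestors_at_input:
  assumes "source ((parent ^^ i) e) = Input l" "source ((parent ^^ j) e) = Input l'"
  shows "(parent ^^ i) e = (parent ^^ j) e"
proof -
  have stay: "(parent ^^ (m + i)) e = (parent ^^ i) e" if "source ((parent ^^ i) e) = Input l" for i m l
    using that by (induction m) (simp_all add: parent_def)
  show ?thesis
    using stay[OF assms(1), of "j - i"] stay[OF assms(2), of "i - j"]
    by (cases "i \<le> j") auto
qed

text \<open>
  If the homogeneous equation holds at all states of a cycle except perhaps at \<open>q\<close>, then the values
  from \<open>\<sigma> q\<close> around the cycle up to \<open>q\<close> are a geometric progression; so they vanish all or none.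
\<close>

lemma cycle_all_nonzero:
  fixes w :: "nat \<Rightarrow> complex"
  assumes c: "c \<noteq> 0" and e: "q < n"
    and eq: "\<And>k. k < n \<Longrightarrow> entry k = entry q \<Longrightarrow> k \<noteq> q \<Longrightarrow> c * w k = of_nat (Suc (entry k)) * w (\<sigma> k)"
    and nz: "l < n" "entry l = entry q" "w l \<noteq> 0"
    and k: "k < n" "entry k = entry q"
  shows "w k \<noteq> 0"
proof -
  have inv: "(\<sigma> ^^ t) q < n \<and> entry ((\<sigma> ^^ t) q) = entry q" for t
    by (induction t) (use e step_less entry_step in auto)
  have step: "w ((\<sigma> ^^ Suc t) q) = 0 \<longleftrightarrow> w (\<sigma> q) = 0" for t
  proof (induction t)
    case (Suc t)
    show ?case
    \<comment> \<open>Back at \<open>q\<close>, the next state is \<open>\<sigma> q\<close> again, and the equation at \<open>q\<close> can be skipped.\<close>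
    proof (cases "(\<sigma> ^^ Suc t) q = q")
      case False
      then have "c * w ((\<sigma> ^^ Suc t) q) = of_nat (Suc (entry q)) * w ((\<sigma> ^^ Suc (Suc t)) q)"
        using eq[of "(\<sigma> ^^ Suc t) q"] inv[of "Suc t"] by simp
      then have "w ((\<sigma> ^^ Suc (Suc t)) q) = 0 \<longleftrightarrow> w ((\<sigma> ^^ Suc t) q) = 0"
        using c by (metis mult_eq_0_iff of_nat_eq_0_iff nat.distinct(1))
      then show ?thesis using Suc by simp
    qed simp
  qed simp
  have "w m = 0 \<longleftrightarrow> w (\<sigma> q) = 0" if "m < n" "entry m = entry q" for m
  proof -
    have "m \<in> orbit \<sigma> q" using same_cycle e that by simp
    then obtain t where "m = (\<sigma> ^^ t) q" "t > 0" unfolding orbit_altdef by blast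
    then show ?thesis using step[of "t - 1"] by simp
  qed
  then show ?thesis using nz k by blast
qed

text \<open>
  Summing the moduli of both sides of the equation over the cycle, \<open>|c| S = (e + 1) S\<close> for the same
  sum \<open>S\<close>, as \<open>\<sigma>\<close> only permutes its terms.
\<close>

lemma eigenvalue_modulus:
  fixes w :: "nat \<Rightarrow> complex"
  assumes eq: "\<And>k. k < n \<Longrightarrow> entry k = e \<Longrightarrow> c * w k = of_nat (Suc e) * w (\<sigma> k)"
    and nz: "l < n" "entry l = e" "w l \<noteq> 0"
  shows "norm c = real (Suc e)"
proof -
  define C where "C = {k. k < n \<and> entry k = e}"
  have fin: "finite C" by (simp add: C_def)
  have "\<sigma> ` C \<subseteq> C" using step_less entry_step by (auto simp: C_def)
  moreover have inj: "inj_on \<sigma> C" using permutes_inj[OF permutes] by (rule inj_on_subset) simp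
  ultimately have "bij_betw \<sigma> C C"
    using endo_inj_surj[OF fin] by (simp add: bij_betw_def)
  then have "(\<Sum>k\<in>C. norm (w (\<sigma> k))) = (\<Sum>k\<in>C. norm (w k))"
    by (rule sum.reindex_bij_betw)
  moreover have "(\<Sum>k\<in>C. norm (c * w k)) = (\<Sum>k\<in>C. norm (of_nat (Suc e) * w (\<sigma> k)))"
    using eq by (intro sum.cong) (auto simp: C_def)
  ultimately have "norm c * (\<Sum>k\<in>C. norm (w k)) = real (Suc e) * (\<Sum>k\<in>C. norm (w k))"
    by (simp add: norm_mult del: of_nat_Suc flip: sum_distrib_left)
  moreover have "(\<Sum>k\<in>C. norm (w k)) \<noteq> 0"
    using nz fin by (auto simp: sum_nonneg_eq_0_iff C_def)
  ultimately show ?thesis by simp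
qed

text \<open>
  Suppose \<open>w\<close> is a nonzero left eigenvector orthogonal to all input columns. On a deepest cycle where
  \<open>w\<close> is not zero, no lower cycle contributes, so the eigenvalue has the modulus of this cycle's
  weight. Weights are distinct, hence every other cycle where \<open>w\<close> is not zero must receive a
  contribution from a cycle below it; so only ancestors of the deepest cycle carry \<open>w\<close>. On each of
  them at most one branch contributes, whence \<open>w\<close> has no zero there, and in particular does not vanish
  at the entry. Upwards, this makes \<open>w\<close> nonzero on the parent, and finally makes the product with
  the input column at the root nonzero, because no second branch can cancel it.
\<close>

lemma no_hidden_eigenvector:
  assumes eig: "\<And>k. k < n \<Longrightarrow> adjoint_action n cycle_weight w k = c * w k"
    and out: "\<And>l. l < p \<Longrightarrow> (\<Sum>i<n. of_real (input_weight i l) * w i) = 0"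
    and inputs: "\<And>e l. e < n \<Longrightarrow> entry e = e \<Longrightarrow> source e = Input l \<Longrightarrow> l < p"
  shows "\<forall>k<n. w k = 0"
proof (rule ccontr)
  assume "\<not> (\<forall>k<n. w k = 0)"
  then obtain k0 where k0: "k0 < n \<and> w k0 \<noteq> 0" by auto
  have eq: "c * w k = of_nat (Suc (entry k)) * w (\<sigma> k) + branch w (State k)" if "k < n" for k
    using eig[OF that] adjoint_cycle_weight[OF that] by simp
  have "\<forall>k. k < n \<and> w k \<noteq> 0 \<longrightarrow> depth (entry k) < Suc (\<Sum>k<n. depth (entry k))"
    by (auto intro!: member_le_sum le_imp_less_Suc)
  from ex_has_greatest_nat[of "\<lambda>k. k < n \<and> w k \<noteq> 0", OF k0 this]
  obtain d where d: "d < n" "w d \<noteq> 0"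
    and deepest: "\<And>k. k < n \<Longrightarrow> w k \<noteq> 0 \<Longrightarrow> depth (entry k) \<le> depth (entry d)"
    by auto
  define e0 where "e0 = entry d"
  have e0: "e0 < n" "entry e0 = e0" using d entry_less entry_entry by (auto simp: e0_def)
  have branch0: "branch w v = 0" if "\<And>i. \<lbrakk>i < n; entry i = i; source i = v; w i \<noteq> 0\<rbrakk> \<Longrightarrow> False" for v
    unfolding branch_def by (rule sum.neutral) (use that in blast)
  have "branch w (State k) = 0" if "k < n" "entry k = e0" for k
    using that deepest source_above e0_def by (intro branch0) fastforce
  then have modulus: "norm c = real (Suc e0)"
    using eq d by (intro eigenvalue_modulus[of e0 c w d]) (auto simp: e0_def)
  then have "c \<noteq> 0" by auto

  have ancestor: "\<exists>i. entry k = (parent ^^ i) e0" if "k < n" "w k \<noteq> 0" for k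
    using that
  proof (induction "depth e0 - depth (entry k)" arbitrary: k rule: less_induct)
    case less
    show ?case
    proof (cases "entry k = e0")
      case True
      then show ?thesis by (metis funpow_0)
    next
      case False
      have "\<exists>m<n. entry m = entry k \<and> branch w (State m) \<noteq> 0"
      proof (rule ccontr)
        assume "\<not> ?thesis"
        then have "norm c = real (Suc (entry k))"
          using eq less.prems by (intro eigenvalue_modulus[of "entry k" c w k]) auto
        then show False using modulus False by simp
      qed
      then obtain m i where m: "m < n" "entry m = entry k"
          and i: "i < n" "entry i = i" "source i = State m" "w i \<noteq> 0"
        using branch0 by blast
      have "depth (entry k) < depth (entry i)"
        using source_above[OF i(1, 3)] m i(2) by simp
      moreover have "depth (entry i) \<le> depth e0"
        using deepest[OF i(1, 4)] by (simp add: e0_def)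
      ultimately have "depth e0 - depth (entry i) < depth e0 - depth (entry k)"
        by linarith
      then obtain j where "i = (parent ^^ j) e0"
        using less.hyps[of i] i(1, 2, 4) by metis
      then have "entry k = (parent ^^ Suc j) e0"
        using i(3) m by (simp add: parent_def)
      then show ?thesis by blast
    qed
  qed

  have unique_child: "i = j"
    if i: "i < n" "entry i = i" "source i = State q" "w i \<noteq> 0"
      and j: "j < n" "entry j = j" "source j = State q'" "w j \<noteq> 0"
      and "entry q = entry q'" for i j q q'
  proof -
    obtain s t where "i = (parent ^^ s) e0" "j = (parent ^^ t) e0"
      using ancestor[OF i(1, 4)] ancestor[OF j(1, 4)] i(2) j(2) by auto
    then show ?thesis
      using ancestors_with_same_parent[OF e0, of s q t q'] i(3) j(3) that(9) by simp
  qed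

  have entry_nonzero: "w (entry k) \<noteq> 0" if k: "k < n" "w k \<noteq> 0" for k
  proof (cases "\<exists>q<n. entry q = entry k \<and> branch w (State q) \<noteq> 0")
    case True
    then obtain q where q: "q < n" "entry q = entry k" "branch w (State q) \<noteq> 0" by blast
    then obtain i where i: "i < n" "entry i = i" "source i = State q" "w i \<noteq> 0"
      using branch0 by blast
    have other: "branch w (State m) = 0" if m: "entry m = entry q" "m \<noteq> q" for m
    proof (rule branch0)
      fix j assume "j < n" "entry j = j" "source j = State m" "w j \<noteq> 0"
      then have "i = j" using unique_child[OF i] m(1) by simp
      then show False using i(3) \<open>source j = State m\<close> m(2) by simp
    qed
    show ?thesis
    proof (rule cycle_all_nonzero[of c q w k])
      show "c * w m = of_nat (Suc (entry m)) * w (\<sigma> m)"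
        if "m < n" "entry m = entry q" "m \<noteq> q" for m
        using eq[OF that(1)] other[OF that(2, 3)] by simp
    qed (simp_all add: k q \<open>c \<noteq> 0\<close> entry_less entry_entry)
  next
    case False
    show ?thesis
    proof (rule cycle_all_nonzero[of c k w k])
      show "c * w m = of_nat (Suc (entry m)) * w (\<sigma> m)" if "m < n" "entry m = entry k" for m
        using eq[OF that(1)] False that by auto
    qed (simp_all add: k \<open>c \<noteq> 0\<close> entry_less entry_entry)
  qed

  have "False" if "k < n" "w k \<noteq> 0" for k
    using that
  proof (induction "depth (entry k)" arbitrary: k rule: less_induct)
    case less
    define e where "e = entry k"
    have e: "e < n" "entry e = e" "w e \<noteq> 0"
      using less.prems entry_less entry_entry entry_nonzero by (auto simp: e_def)
    show False
    proof (cases "source e")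
      case (State q)
      have q: "q < n" "depth (entry q) < depth e" using source_above[OF e(1) State] by auto
      have "branch w (State q) = (\<Sum>i\<in>{e}. w i)"
        unfolding branch_def
      proof (rule sum.mono_neutral_right)
        show "\<forall>i\<in>{i. i < n \<and> entry i = i \<and> source i = State q} - {e}. w i = 0"
          using unique_child[OF e(1, 2) State e(3)] by blast
      qed (use e(1, 2) State in auto)
      then have "w q \<noteq> 0 \<or> w (\<sigma> q) \<noteq> 0"
        using eq[OF q(1)] e(3) by auto
      then show False
        using less.hyps[of q] less.hyps[of "\<sigma> q"] q step_less[OF q(1)] entry_step[OF q(1)]
        by (auto simp: e_def)
    next
      case (Input l)
      obtain s where s: "e = (parent ^^ s) e0"
        using ancestor[OF e(1, 3)] e(2) by auto
      have "branch w (Input l) = (\<Sum>i\<in>{e}. w i)"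
        unfolding branch_def
      proof (rule sum.mono_neutral_right)
        show "\<forall>i\<in>{i. i < n \<and> entry i = i \<and> source i = Input l} - {e}. w i = 0"
        proof (intro ballI, rule ccontr)
          fix i assume i: "i \<in> {i. i < n \<and> entry i = i \<and> source i = Input l} - {e}" "w i \<noteq> 0"
          then obtain t where "i = (parent ^^ t) e0"
            using ancestor[of i] by auto
          then have "e = i"
            using ancestors_at_input[of s e0 l t l] s i(1) Input by simp
          then show False using i(1) by simp
        qed
      qed (use e(1, 2) Input in auto)
      then show False
        using out[of l] inputs[OF e(1, 2) Input] e(3) by (simp add: input_weight_sum)
    qed
  qed
  with k0 show False by blast
qed

end

section \<open>Spanning cycles and accessible states\<close>

text \<open>
  There is a path from an input to the state \<open>k\<close> with \<open>t\<close> edges between states.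
\<close>

primrec driven_in :: "bit mat \<Rightarrow> bit mat \<Rightarrow> nat \<Rightarrow> nat \<Rightarrow> bool" where
  "driven_in M N 0 k \<longleftrightarrow> (\<exists>l < dim_col N. N $$ (k, l) = 1)"
| "driven_in M N (Suc t) k \<longleftrightarrow> (\<exists>q < dim_row M. driven_in M N t q \<and> M $$ (k, q) = 1)"

text \<open>
  The case of Lin's theorem in which disjoint cycles of the state digraph contain all states. The
  depth of a state is its distance from the inputs. The entry of a cycle is a state of least depth
  on it, and its source is the preceding vertex on a shortest path. A state that is the source of
  an entry is closer to the inputs than the entry, and the entry of its own cycle is at least as
  close; so the cycles form a forest.
\<close>

theorem structurally_controllable_if_cycles_and_driven:
  assumes M: "M \<in> carrier_mat n n" and N: "N \<in> carrier_mat n p"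
    and \<sigma>: "\<sigma> permutes {..<n}" "\<And>k. k < n \<Longrightarrow> M $$ (\<sigma> k, k) = 1"
    and driven: "\<And>k. k < n \<Longrightarrow> \<exists>t. driven_in M N t k"
  shows "structurally_controllable M N"
proof -
  define depth where "depth k = (LEAST t. driven_in M N t k)" for k
  \<comment> \<open>The minimum is chosen from the orbit as a set, which makes it the same for all states of a cycle.\<close>
  define entry where "entry k = arg_min_on depth (orbit \<sigma> k)" for k
  define source where "source k = (if depth k = 0 then Input (SOME l. l < p \<and> N $$ (k, l) = 1)
      else State (SOME q. q < n \<and> driven_in M N (depth k - 1) q \<and> M $$ (k, q) = 1))" for k
  have dims [simp]: "dim_row M = n" "dim_col N = p" using M N by auto
  have depth: "driven_in M N (depth k) k" if "k < n" for k
    using driven[OF that] unfolding depth_def by (rule LeastI_ex)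
  have depth_le: "depth k \<le> t" if "driven_in M N t k" for k t
    using that unfolding depth_def by (rule Least_le)

  have perm: "permutation \<sigma>"
    using \<sigma>(1) by (auto simp: permutation_permutes)
  have self: "k \<in> orbit \<sigma> k" for k
    using perm by (rule permutation_self_in_orbit)
  then have fin: "finite (orbit \<sigma> k)" for k
    by (rule finite_orbit)
  have entry: "entry k \<in> orbit \<sigma> k" "depth (entry k) \<le> depth k" for k
    using arg_min_if_finite[OF fin[of k], of depth] self[of k]
    by (auto simp: entry_def not_less)
  have same_orbit: "orbit \<sigma> l = orbit \<sigma> k" if "l \<in> orbit \<sigma> k" for k l
    using cyclic_on_orbit'[OF perm] that by (rule orbit_cyclic_eq3)

  have input: "\<exists>l. source k = Input l \<and> l < p \<and> N $$ (k, l) = 1" if "k < n" "depth k = 0" for k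
  proof -
    have "\<exists>l. l < p \<and> N $$ (k, l) = 1" using depth[OF that(1)] that(2) by simp
    from someI_ex[OF this] show ?thesis using that(2) by (simp add: source_def)
  qed
  have state: "\<exists>q. source k = State q \<and> q < n \<and> driven_in M N (depth k - 1) q \<and> M $$ (k, q) = 1"
    if "k < n" "depth k \<noteq> 0" for k
  proof -
    obtain t where "depth k = Suc t" using \<open>depth k \<noteq> 0\<close> by (cases "depth k") auto
    then have "\<exists>q. q < n \<and> driven_in M N (depth k - 1) q \<and> M $$ (k, q) = 1"
      using depth[OF that(1)] by auto
    from someI_ex[OF this] show ?thesis using that(2) by (simp add: source_def)
  qed

  interpret rooted_cycles n \<sigma> entry source depth
  proof
    fix k l assume k: "k < n"
    show "entry k < n"
      using entry(1)[of k] permutes_orbit_subset[OF \<sigma>(1), of k] k by auto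
    show "entry (\<sigma> k) = entry k"
      by (simp add: entry_def permutation_orbit_step[OF perm])
    show "entry (entry k) = entry k"
      using same_orbit[OF entry(1)] by (simp add: entry_def[of "entry k"]) (simp add: entry_def)
    show "l \<in> orbit \<sigma> k" if "entry k = entry l"
      using same_orbit[OF entry(1)] self that by metis
  next
    fix e q assume e: "e < n" "source e = State q"
    then have "depth e \<noteq> 0" using input by fastforce
    with state[OF e(1)] e(2) have q: "q < n" "driven_in M N (depth e - 1) q" by auto
    have "depth (entry q) \<le> depth e - 1"
      using entry(2) depth_le[OF q(2)] by (rule le_trans)
    then show "q < n \<and> depth (entry q) < depth e"
      using q(1) \<open>depth e \<noteq> 0\<close> by auto
  qed (rule \<sigma>(1))

  have source_input: "l < p \<and> N $$ (k, l) = 1" if "k < n" "source k = Input l" for k l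
    using that input state by (cases "depth k = 0") fastforce+
  have source_state: "M $$ (k, q) = 1" if "k < n" "source k = State q" for k q
    using that input state by (cases "depth k = 0") fastforce+

  have "det (gramian n p cycle_weight input_weight) \<noteq> 0"
    using no_hidden_eigenvector[where p = p] source_input
    by (intro det_gramian_if_no_hidden_eigenvector) blast
  then show ?thesis
    using M N \<sigma>(2) source_input source_state
    by (intro structurally_controllable_if_subpattern[of M n N p cycle_weight input_weight])
      (auto simp: cycle_weight_def input_weight_def split: if_splits)
qed

section \<open>Accessibility within the subsystems\<close>

text \<open>
  Among the vertices that reach \<open>v\<close>, take one with the fewest ancestors. An edge into its component
  starts at a vertex with the same ancestors, which therefore belongs to the component as well.
\<close>

lemma (in pair_fin_digraph) ex_non_top_linked_scc_above:
  assumes v: "v \<in> pverts G"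
  shows "\<exists>C u. non_top_linked_scc G C \<and> u \<in> C \<and> u \<rightarrow>\<^sup>*\<^bsub>with_proj G\<^esub> v"
proof -
  define anc where "anc u = {w. w \<rightarrow>\<^sup>*\<^bsub>with_proj G\<^esub> u}" for u
  have fin: "finite (anc u)" for u
  proof (rule finite_subset)
    show "anc u \<subseteq> pverts G" using reachable_in_verts by (auto simp: anc_def)
  qed simp
  have "v \<rightarrow>\<^sup>*\<^bsub>with_proj G\<^esub> v" using v by simp
  from ex_has_least_nat[of "\<lambda>u. u \<rightarrow>\<^sup>*\<^bsub>with_proj G\<^esub> v", OF this, of "\<lambda>u. card (anc u)"]
  obtain u where u: "u \<rightarrow>\<^sup>*\<^bsub>with_proj G\<^esub> v"
    and min: "\<And>w. w \<rightarrow>\<^sup>*\<^bsub>with_proj G\<^esub> v \<Longrightarrow> card (anc u) \<le> card (anc w)"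
    by blast
  have uG: "u \<in> pverts G" using reachable_in_verts(1)[OF u] by simp
  have scc: "scc_of u \<in> sccs_verts"
    by (rule scc_of_in_sccs_verts) (simp add: uG)
  have "non_top_linked_scc G (scc_of u)"
    unfolding non_top_linked_scc_def
  proof (intro conjI notI scc)
    assume "\<exists>C\<in>sccs_verts. C \<noteq> scc_of u \<and> (\<exists>a\<in>C. \<exists>b\<in>scc_of u. (a, b) \<in> parcs G)"
    then obtain C a b where C: "C \<in> sccs_verts" "C \<noteq> scc_of u" "a \<in> C"
      and b: "b \<in> scc_of u" "(a, b) \<in> parcs G" by blast
    have "a \<rightarrow>\<^sup>*\<^bsub>with_proj G\<^esub> b" using b(2) by (intro reachable_adjI) (simp add: arcs_ends_def arc_to_ends_def)
    then have au: "a \<rightarrow>\<^sup>*\<^bsub>with_proj G\<^esub> u"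
      using b(1) by (auto simp: scc_of_def intro: reachable_trans)
    then have "anc a \<subseteq> anc u" by (auto simp: anc_def intro: reachable_trans)
    moreover have "card (anc u) \<le> card (anc a)"
      using au u by (intro min) (rule reachable_trans)
    ultimately have "anc a = anc u"
      using fin by (metis card_seteq)
    moreover have "u \<in> anc u" using uG by (simp add: anc_def)
    ultimately have "a \<in> scc_of u"
      using au by (auto simp: scc_of_def anc_def)
    then show False
      using sccs_verts_disjoint[OF C(1) scc C(2)] C(3) by blast
  qed
  moreover have "u \<in> scc_of u" using uG by (simp add: scc_of_def)
  ultimately show ?thesis using u by blast
qed

lemma pair_fin_digraph_system_digraph: "pair_fin_digraph (system_digraph M N)"
proof
  show fin: "finite (pverts (system_digraph M N))"
    by (simp add: system_digraph_def state_digraph_def)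
  have sub: "parcs (system_digraph M N) \<subseteq> pverts (system_digraph M N) \<times> pverts (system_digraph M N)"
    by (auto simp: system_digraph_def state_digraph_def)
  then show "finite (parcs (system_digraph M N))"
    by (rule finite_subset) (simp add: fin)
  show "fst e \<in> pverts (system_digraph M N)" "snd e \<in> pverts (system_digraph M N)"
    if "e \<in> parcs (system_digraph M N)" for e
    using sub that by auto
qed

text \<open>
  A non-top linked component above the state contains, by assumption, an input.
\<close>

lemma reachable_from_input:
  assumes scc: "\<And>C. non_top_linked_scc (system_digraph M N) C \<Longrightarrow> C \<subseteq> range Input"
    and k: "k < dim_row M"
  shows "\<exists>l. Input l \<rightarrow>\<^sup>*\<^bsub>with_proj (system_digraph M N)\<^esub> State k"
proof -
  interpret pair_fin_digraph "system_digraph M N" by (rule pair_fin_digraph_system_digraph)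
  have "State k \<in> pverts (system_digraph M N)"
    using k by (simp add: system_digraph_def state_digraph_def)
  from ex_non_top_linked_scc_above[OF this] scc show ?thesis by blast
qed

text \<open>
  Paths inside a subsystem are paths of the overall system. Every edge of the subsystem appears
  in a diagonal block.
\<close>

lemma driven_in_overall:
  assumes A: "\<And>i. i < r \<Longrightarrow> A i \<in> carrier_mat (ns i) (ns i)"
    and B: "\<And>i. i < r \<Longrightarrow> B i \<in> carrier_mat (ns i) (ps i)"
    and i: "i < r"
    and path: "Input l \<rightarrow>\<^sup>*\<^bsub>with_proj (system_digraph (A i) (B i))\<^esub> State k"
  shows "\<exists>t. driven_in (overall_state_mat r ns A E) (overall_input_mat r B) t (block_start ns i + k)"
proof -
  interpret pair_fin_digraph "system_digraph (A i) (B i)" by (rule pair_fin_digraph_system_digraph)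
  let ?M = "overall_state_mat r ns A E" and ?N = "overall_input_mat r B"
  have dims: "dim_row (A i) = ns i" "dim_col (B i) = ps i"
      "dim_row ?M = (\<Sum>i<r. ns i)" "dim_col ?N = (\<Sum>i<r. ps i)"
    using A[OF i] B[OF i] overall_state_mat_carrier[of r ns A E]
      overall_input_mat_carrier[of r B ns ps] B by auto
  have "\<forall>k. v = State k \<longrightarrow> (\<exists>t. driven_in ?M ?N t (block_start ns i + k))"
    if "Input l \<rightarrow>\<^sup>*\<^bsub>with_proj (system_digraph (A i) (B i))\<^esub> v" for v
    using that
  proof (induction rule: reachable_induct)
    case (step v w)
    have edge: "(v, w) \<in> parcs (system_digraph (A i) (B i))"
      using step.hyps by (auto simp: arcs_ends_def arc_to_ends_def)
    show ?case
    proof (intro allI impI)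
      fix k assume w: "w = State k"
      show "\<exists>t. driven_in ?M ?N t (block_start ns i + k)"
      proof (cases v)
        case (State q)
        then have q: "k < ns i" "q < ns i" "A i $$ (k, q) = 1"
          using edge w dims by (auto simp: system_digraph_def state_digraph_def)
        then have "?M $$ (block_start ns i + k, block_start ns i + q) = 1"
          by (simp add: overall_state_mat_block[OF i i])
        moreover obtain t where "driven_in ?M ?N t (block_start ns i + q)"
          using step.IH State by blast
        ultimately have "driven_in ?M ?N (Suc t) (block_start ns i + k)"
          using block_start_add_less[of i r q ns] i q dims by auto
        then show ?thesis by blast
      next
        case (Input l)
        then have l: "k < ns i" "l < ps i" "B i $$ (k, l) = 1"
          using edge w dims by (auto simp: system_digraph_def state_digraph_def)
        then have "?N $$ (block_start ns i + k, block_start ps i + l) = 1"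
          using overall_input_mat_block[OF B i i, where k = k and l = l] by simp
        then have "driven_in ?M ?N 0 (block_start ns i + k)"
          using block_start_add_less[of i r l ps] i l dims by auto
        then show ?thesis by blast
      qed
    qed
  qed simp
  then show ?thesis using path by blast
qed

section \<open>Matchings of the interconnected system\<close>

text \<open>
  A matching of the state bipartite graph that covers the left vertices is the graph of an injection
  of a finite set into itself, hence of a permutation; its cycles are cycles of the state digraph.
\<close>

lemma permutation_of_matching:
  assumes total: "\<And>k. k < n \<Longrightarrow> \<exists>l<n. (State k, State l) \<in> F"
    and unique: "\<And>v w x. (v, x) \<in> F \<Longrightarrow> (w, x) \<in> F \<Longrightarrow> v = w"
  shows "\<exists>\<sigma>. \<sigma> permutes {..<n} \<and> (\<forall>k<n. (State k, State (\<sigma> k)) \<in> F)"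
proof -
  obtain f where f: "\<And>k. k < n \<Longrightarrow> f k < n \<and> (State k, State (f k)) \<in> F"
    using total by metis
  define \<sigma> where "\<sigma> k = (if k < n then f k else k)" for k
  have "inj_on \<sigma> {..<n}"
    using f unique by (auto simp: inj_on_def \<sigma>_def) (metis vertex.inject(1))
  moreover have "\<sigma> ` {..<n} \<subseteq> {..<n}" using f by (auto simp: \<sigma>_def)
  ultimately have "bij_betw \<sigma> {..<n} {..<n}"
    by (simp add: bij_betw_def endo_inj_surj)
  then have "\<sigma> permutes {..<n}"
    by (rule bij_imp_permutes) (simp add: \<sigma>_def)
  then show ?thesis using f by (auto simp: \<sigma>_def)
qed

lemma block_decomposition:
  "x < (\<Sum>i<r. ns i) \<Longrightarrow> \<exists>i<r. \<exists>k<ns i. x = block_start ns i + k"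
proof (induction r)
  case (Suc r)
  show ?case
  proof (cases "x < (\<Sum>i<r. ns i)")
    case True
    then show ?thesis using Suc.IH less_SucI by blast
  next
    case False
    then show ?thesis using Suc.prems
      by (intro exI[of _ r] conjI exI[of _ "x - (\<Sum>i<r. ns i)"]) (auto simp: block_start_def)
  qed
qed simp

lemma overall_vertex_inject:
  assumes "k < ns i" "l < ns j" "overall_vertex ns ps i (State k) = overall_vertex ns ps j (State l)"
  shows "i = j \<and> k = l"
proof -
  have eq: "block_start ns i + k = block_start ns j + l" using assms(3) by simp
  then have "i = j"
    using block_of_block_start[of k ns i] block_of_block_start[of l ns j] assms(1, 2) by simp
  then show ?thesis using eq by simp
qed

text \<open>
  \<open>F\<close> joins the matchings of the subsystems with the perfect matching \<open>P\<close> of what they leave unmatched.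
  A left vertex not covered within its subsystem is covered by \<open>P\<close>, and no right vertex is covered
  twice, since \<open>P\<close> uses right-unmatched vertices only. So \<open>F\<close> matches all states of the overall system.
\<close>

theorem lemma3:
  fixes r :: nat
    and ns ps :: "nat \<Rightarrow> nat"
    and A B :: "nat \<Rightarrow> bit mat"
    and E :: "nat \<Rightarrow> nat \<Rightarrow> bit mat"
  assumes A: "\<And>i. i < r \<Longrightarrow> A i \<in> carrier_mat (ns i) (ns i)"
    and B: "\<And>i. i < r \<Longrightarrow> B i \<in> carrier_mat (ns i) (ps i)"
    and E: "\<And>i j. i < r \<Longrightarrow> j < r \<Longrightarrow> i \<noteq> j \<Longrightarrow> E i j \<in> carrier_mat (ns i) (ns j)"
    and matchings: "\<exists>M :: nat \<Rightarrow> (vertex \<times> vertex) set.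
      (\<forall>i<r. maximum_matching (state_bipartite (A i)) (M i)) \<and>
      (\<forall>j<r. \<forall>C. non_top_linked_scc (system_digraph (A j) (B j)) C \<longrightarrow> C \<subseteq> range Input) \<and>
      (\<exists>P. perfect_matching
        \<lparr> left_verts = (\<Union>i<r. overall_left_unmatched ns ps A M i),
          right_verts = (\<Union>i<r. overall_right_unmatched ns ps A M i),
          bip_edges = (\<Union>i<r. \<Union>j\<in>{..<r} - {i}.
            edges_between (state_digraph (overall_state_mat r ns A E))
              (overall_left_unmatched ns ps A M j) (overall_right_unmatched ns ps A M i)) \<rparr> P)"
  shows "structurally_controllable (overall_state_mat r ns A E) (overall_input_mat r B)"
proof -
  let ?n = "\<Sum>i<r. ns i"
  let ?M = "overall_state_mat r ns A E" and ?N = "overall_input_mat r B"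
  from matchings obtain M P where max: "\<forall>i<r. maximum_matching (state_bipartite (A i)) (M i)"
    and scc: "\<forall>j<r. \<forall>C. non_top_linked_scc (system_digraph (A j) (B j)) C \<longrightarrow> C \<subseteq> range Input"
    and P: "perfect_matching
        \<lparr> left_verts = (\<Union>i<r. overall_left_unmatched ns ps A M i),
          right_verts = (\<Union>i<r. overall_right_unmatched ns ps A M i),
          bip_edges = (\<Union>i<r. \<Union>j\<in>{..<r} - {i}.
            edges_between (state_digraph ?M)
              (overall_left_unmatched ns ps A M j) (overall_right_unmatched ns ps A M i)) \<rparr> P"
      (is "perfect_matching ?G P")
    by (elim exE conjE) (rule that)
  have M: "bip_matching (state_bipartite (A i)) (M i)" if "i < r" for i
    using max that by (simp add: maximum_matching_def)
  let ?ov = "\<lambda>i. overall_vertex ns ps i"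
  have dimA: "dim_row (A i) = ns i" if "i < r" for i using A[OF that] by simp
  have M_edge: "\<exists>k l. e = (State k, State l) \<and> k < ns i \<and> l < ns i \<and> A i $$ (l, k) = 1"
    if "i < r" "e \<in> M i" for i e
  proof -
    have "e \<in> parcs (state_digraph (A i))"
      using M[OF that(1)] that(2) by (auto simp: bip_matching_def state_bipartite_def)
    then show ?thesis by (auto simp: state_digraph_def dimA[OF that(1)])
  qed
  have P_edge: "\<exists>i<r. \<exists>k<ns i. snd e = ?ov i (State k) \<and> (\<forall>f\<in>M i. snd f \<noteq> State k)"
      "e \<in> parcs (state_digraph ?M)" if "e \<in> P" for e
  proof -
    have "P \<subseteq> bip_edges ?G"
      using P unfolding perfect_matching_def bip_matching_def by (elim conjE)
    then have "e \<in> bip_edges ?G" using that by (rule subsetD)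
    then obtain i j where i: "i < r" and e: "e \<in> edges_between (state_digraph ?M)
        (overall_left_unmatched ns ps A M j) (overall_right_unmatched ns ps A M i)"
      by (auto simp only: bipartite.simps UN_iff lessThan_iff)
    from e show "e \<in> parcs (state_digraph ?M)" by (simp add: edges_between_def)
    from e have "snd e \<in> overall_right_unmatched ns ps A M i"
      by (auto simp: edges_between_def)
    then obtain v where v: "snd e = ?ov i v" "v \<in> right_unmatched (state_bipartite (A i)) (M i)"
      unfolding overall_right_unmatched_def by blast
    then have "v \<in> State ` {..<ns i}" "\<forall>f\<in>M i. snd f \<noteq> v"
      by (simp_all add: right_unmatched_def state_bipartite_def state_digraph_def dimA[OF i])
    then show "\<exists>i<r. \<exists>k<ns i. snd e = ?ov i (State k) \<and> (\<forall>f\<in>M i. snd f \<noteq> State k)"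
      using i v(1) by blast
  qed
  have M_inj: "v = w" if "i < r" "(v, x) \<in> M i" "(w, x) \<in> M i" for i v w x
    using M[OF that(1)] that(2, 3) by (fastforce simp: bip_matching_def)
  have P_inj: "v = w" if "(v, x) \<in> P" "(w, x) \<in> P" for v w x
    using P that by (fastforce simp: perfect_matching_def bip_matching_def)

  define F where "F = (\<Union>i<r. (\<lambda>(v, w). (?ov i v, ?ov i w)) ` M i) \<union> P"
  have F_edge: "?M $$ (l, k) = 1" if kl: "(State k, State l) \<in> F" for k l
  proof (cases "(State k, State l) \<in> P")
    case True
    then show ?thesis using P_edge(2) by (fastforce simp: state_digraph_def)
  next
    case False
    then obtain i v w where i: "i < r" "(v, w) \<in> M i" "State k = ?ov i v" "State l = ?ov i w"
      using kl by (auto simp: F_def)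
    from M_edge[OF i(1, 2)] obtain k' l' where
      "v = State k'" "w = State l'" "k' < ns i" "l' < ns i" "A i $$ (l', k') = 1" by auto
    then show ?thesis
      using i overall_state_mat_block[OF i(1) i(1), of l' ns k' A E] by simp
  qed
  have "\<exists>l<?n. (State x, State l) \<in> F" if x: "x < ?n" for x
  proof -
    obtain i k where i: "i < r" "k < ns i" "x = block_start ns i + k"
      using block_decomposition[OF x] by blast
    show ?thesis
    proof (cases "\<exists>e\<in>M i. fst e = State k")
      case True
      then obtain l where l: "(State k, State l) \<in> M i" "l < ns i" 
        using M_edge[OF i(1)] by fastforce
      then have "(State x, State (block_start ns i + l)) \<in> F"
        using i l(1) unfolding F_def
        by (intro UnI1 UN_I[of i] image_eqI[of _ _ "(State k, State l)"]) simp_all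
      then show ?thesis using block_start_add_less[of i r l ns] i(1) l(2) by blast
    next
      case False
      then have "State k \<in> left_unmatched (state_bipartite (A i)) (M i)"
        using i dimA by (auto simp: left_unmatched_def state_bipartite_def state_digraph_def)
      then have "State x \<in> left_verts ?G"
        using i unfolding overall_left_unmatched_def bipartite.simps
        by (intro UN_I[of i] image_eqI[of _ _ "State k"]) simp_all
      moreover have "left_unmatched ?G P = {}" using P by (simp add: perfect_matching_def)
      ultimately obtain e where e: "e \<in> P" "fst e = State x"
        unfolding left_unmatched_def by blast
      then obtain l where "l < ?n" "e = (State x, State l)"
        using P_edge(2)[OF e(1)] by (auto simp: state_digraph_def overall_state_mat_def)
      then show ?thesis using e(1) unfolding F_def by blast
    qed
  qed
  moreover have "v = w" if F: "(v, x) \<in> F" "(w, x) \<in> F" for v w x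
  proof -
    \<comment> \<open>An edge of \<open>P\<close> never ends where an edge of a subsystem matching ends.\<close>
    have no: False
      if vP: "(v, x) \<in> P" and wM: "(w', x') \<in> M i" and i: "i < r" and x: "x = ?ov i x'"
      for v x w' x' i
    proof -
      obtain j k where j: "j < r" "k < ns j" "x = ?ov j (State k)" "\<forall>f\<in>M j. snd f \<noteq> State k"
        using P_edge(1)[OF vP] by auto
      obtain l where l: "x' = State l" "l < ns i" using M_edge[OF i wM] by auto
      have "j = i \<and> k = l"
        using j(2, 3) l x by (intro overall_vertex_inject[of _ ns _ _ _ ps]) simp_all
      then show False using j(4) wM l(1) by auto
    qed
    \<comment> \<open>Matchings of different subsystems end in different blocks.\<close>
    have yes: "v = w"
      if vM: "(v', x') \<in> M i" "i < r" "v = ?ov i v'" "x = ?ov i x'"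
        and wM: "(w', x'') \<in> M j" "j < r" "w = ?ov j w'" "x = ?ov j x''" for v' x' i w' x'' j
    proof -
      obtain k l where kl: "x' = State k" "x'' = State l" "k < ns i" "l < ns j"
        using M_edge[OF vM(2, 1)] M_edge[OF wM(2, 1)] by auto
      then have "i = j \<and> k = l"
        using vM(4) wM(4) by (intro overall_vertex_inject[of _ ns _ _ _ ps]) simp_all
      then have "v' = w'" using M_inj[OF vM(2, 1), of w'] wM(1) kl by simp
      then show ?thesis using vM(3) wM(3) \<open>i = j \<and> k = l\<close> by simp
    qed
    have cases: "(v, x) \<in> P \<or> (\<exists>i<r. \<exists>v' x'. (v', x') \<in> M i \<and> v = ?ov i v' \<and> x = ?ov i x')"
      if "(v, x) \<in> F" for v x
      using that by (auto simp: F_def)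
    from cases[OF F(1)] cases[OF F(2)] show ?thesis
    proof (elim disjE exE conjE)
      assume "(v, x) \<in> P" "(w, x) \<in> P" then show ?thesis by (rule P_inj)
    next
      fix i v' x' assume "(v, x) \<in> P" "i < r" "(v', x') \<in> M i" "x = ?ov i x'"
      then show ?thesis using no by blast
    next
      fix i v' x' assume "(w, x) \<in> P" "i < r" "(v', x') \<in> M i" "x = ?ov i x'"
      then show ?thesis using no by blast
    next
      fix i v' x' j w' x''
      assume "i < r" "(v', x') \<in> M i" "v = ?ov i v'" "x = ?ov i x'"
        and "j < r" "(w', x'') \<in> M j" "w = ?ov j w'" "x = ?ov j x''"
      then show ?thesis by (intro yes[of v' x' i w' x'' j])
    qed
  qed
  ultimately obtain \<sigma> where \<sigma>: "\<sigma> permutes {..<?n}" "\<And>k. k < ?n \<Longrightarrow> (State k, State (\<sigma> k)) \<in> F"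
    using permutation_of_matching[of ?n F] by blast

  have "\<exists>t. driven_in ?M ?N t x" if x: "x < ?n" for x
  proof -
    obtain i k where i: "i < r" "k < ns i" "x = block_start ns i + k"
      using block_decomposition[OF x] by blast
    moreover have "\<exists>l. Input l \<rightarrow>\<^sup>*\<^bsub>with_proj (system_digraph (A i) (B i))\<^esub> State k"
      using scc i(1, 2) dimA[OF i(1)] by (intro reachable_from_input) simp_all
    ultimately show ?thesis using driven_in_overall[of r A ns B ps i _ k E, OF A B i(1)] by blast
  qed
  then show ?thesis
    using \<sigma> F_edge overall_state_mat_carrier overall_input_mat_carrier[of r B ns ps, OF B]
    by (intro structurally_controllable_if_cycles_and_driven[of _ ?n _ "\<Sum>i<r. ps i" \<sigma>]) auto
qed

end
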